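(* Let $X$ be any manifold among the torus $T^6$, the Iwasawa manifold $\mathcal{I}$ and the holomorphically parallelizable Nakamura manifold $\mathcal{N}$. There is an almost complex structure $J_0$ on $X$ such that for each $k\in\{0,1,2,3\}$ there exist $\epsilon>0$ and a curve of almost complex structures $J(s)$ on $X$, $s\in\mathbb{C}$, $|s|<\epsilon$, with $J(0)=J_0$, such that (i) $J_0$ is integrable; (ii) the operator $\bar\mu_s$ associated to $J(s)$ has constant rank $k$ for all $s\neq0$ such that $|s|<\epsilon$. In particular, each neighborhood of $J_0$ contains almost complex structures whose Nijenhuis tensor has arbitrary constant rank $k \in \{0,1,2,3\}$.
   Context: $T^6$ is the $6$-dimensional real torus. The Iwasawa manifold is the compact quotient $\mathcal{I}=\mathbb{H}_3^{\mathbb{C}}/(\mathbb{H}_3^{\mathbb{C}}\cap SL(3,\mathbb{Z}[i]))$ of the complex Heisenberg group $\mathbb{H}_3^{\mathbb{C}}$ of $3\times3$ upper triangular unipotent complex matrices. The Nakamura manifold is the quotient $\mathcal{N}=\Gamma\backslash G$, where $G=\mathbb{C}\ltimes_\psi\mathbb{C}^2$ with coordinates $z_1,z_2,z_3$ and $\psi(z_1)=\operatorname{diag}(e^{z_1},e^{-z_1})$, and $\Gamma\subset G$ is a suitable lattice such that the holomorphic forms $\phi^1=dz_1$, $\phi^2=e^{-z_1}dz_2$, $\phi^3=e^{z_1}dz_3$ descend to $\mathcal{N}$. A curve of almost complex structures $J(s)$, $|s|<\epsilon$, through $J(0)=J_0$ is one defined by the $(1,0)$-forms $\omega^j_s=\phi^j+s\sum_k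 f^j_k\,\overline{\phi^k}$, $j=1,2,3$, where $\{\phi^j\}$ is a global co-frame of $(1,0)$-forms for $J_0$, the $f^j_k$ are complex-valued smooth functions on $X$, and the $\omega_s^j$ and their conjugates are linearly independent at every point. Neighborhoods are taken in the space of almost complex structures on $X$ with the $C^0$ topology. For an almost complex structure $J$, $\bar\mu:=\pi^{0,2}\circ d\colon A^{1,0}_x\to A^{0,2}_x$, where $\pi^{0,2}$ is the projection of complex $2$-forms onto $(0,2)$-forms; the rank of $N_J$ at $x$ is the complex rank of this map, and it is constant equal to $k$ if it is $k$ at every $x$. $\bar\mu_s$ is this operator for $J(s)$. *)

theory Defs
  imports "HOL-Analysis.Analysis" "HOL-Algebra.Coset" "HOL-Library.Function_Algebras"
begin

section \<open>Smooth maps and atlases\<close>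

text \<open>On an open subset of a finite-dimensional space, \<open>smooth_on\<close> is \<open>C\<^sup>\<infinity>\<close>: all iterated
  directional derivatives exist, as values of Frechet derivatives, and are continuous.\<close>

primrec Ck_on ::
  "nat \<Rightarrow> 'a::real_normed_vector set \<Rightarrow> ('a \<Rightarrow> 'b::real_normed_vector) \<Rightarrow> bool" where
  "Ck_on 0 S f \<longleftrightarrow> continuous_on S f"
| "Ck_on (Suc k) S f \<longleftrightarrow> (\<forall>x\<in>S. f differentiable (at x)) \<and>
     (\<forall>v. Ck_on k S (\<lambda>x. frechet_derivative f (at x) v))"

definition smooth_on ::
  "'a::real_normed_vector set \<Rightarrow> ('a \<Rightarrow> 'b::real_normed_vector) \<Rightarrow> bool" where
  "smooth_on S f \<longleftrightarrow> (\<forall>k. Ck_on k S f)"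

text \<open>A chart is a pair of its domain in the manifold and its coordinate map; a manifold is given
  by an atlas, its underlying set being the union of the chart domains.\<close>

type_synonym ('p, 'e) chart = "'p set \<times> ('p \<Rightarrow> 'e)"

definition chart_image :: "('p, 'e) chart \<Rightarrow> 'e set" where
  "chart_image c = snd c ` fst c"

definition chart_inv :: "('p, 'e) chart \<Rightarrow> 'e \<Rightarrow> 'p" where
  "chart_inv c = inv_into (fst c) (snd c)"

definition transition :: "('p, 'e) chart \<Rightarrow> ('p, 'e) chart \<Rightarrow> 'e \<Rightarrow> 'e" where
  "transition c c' = snd c' \<circ> chart_inv c"

text \<open>The differential of the coordinate change from \<open>c\<close> to \<open>c'\<close> at a point \<open>p\<close> of both domains;
  it turns the components of a tangent vector in \<open>c\<close> into those in \<open>c'\<close>.\<close>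

definition dtransition ::
  "('p, 'e::euclidean_space) chart \<Rightarrow> ('p, 'e) chart \<Rightarrow> 'p \<Rightarrow> 'e \<Rightarrow> 'e" where
  "dtransition c c' p = frechet_derivative (transition c c') (at (snd c p))"

definition smooth_function ::
  "('p, 'e::euclidean_space) chart set \<Rightarrow> ('p \<Rightarrow> complex) \<Rightarrow> bool" where
  "smooth_function M f \<longleftrightarrow> (\<forall>c\<in>M. smooth_on (chart_image c) (f \<circ> chart_inv c))"

section \<open>Almost complex structures and complex-valued 1-forms\<close>

text \<open>Tensor fields are given by their components in all charts, subject to the transformation
  rule: \<open>J c x v\<close> and \<open>\<alpha> c x v\<close> are the values at the point with coordinates \<open>x\<close> in the chart \<open>c\<close>
  on the tangent vector with components \<open>v\<close> in \<open>c\<close>. The values outside charts are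
  fixed to 0 for endomorphism fields, so that equality of almost complex structures is
  equality of functions.\<close>

type_synonym ('p, 'e) endo_field = "('p, 'e) chart \<Rightarrow> 'e \<Rightarrow> 'e \<Rightarrow> 'e"

type_synonym ('p, 'e) form1 = "('p, 'e) chart \<Rightarrow> 'e \<Rightarrow> 'e \<Rightarrow> complex"

definition almost_complex_structure ::
  "('p, 'e::euclidean_space) chart set \<Rightarrow> ('p, 'e) endo_field \<Rightarrow> bool" where
  "almost_complex_structure M J \<longleftrightarrow>
     (\<forall>c\<in>M. \<forall>x\<in>chart_image c. linear (J c x) \<and> (\<forall>v. J c x (J c x v) = - v)) \<and>
     (\<forall>c\<in>M. \<forall>v. smooth_on (chart_image c) (\<lambda>x. J c x v)) \<and>
     (\<forall>c\<in>M. \<forall>c'\<in>M. \<forall>p\<in>fst c \<inter> fst c'. \<forall>v.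
        dtransition c c' p (J c (snd c p) v) = J c' (snd c' p) (dtransition c c' p v)) \<and>
     (\<forall>c x v. \<not> (c \<in> M \<and> x \<in> chart_image c) \<longrightarrow> J c x v = 0)"

definition smooth_form1 ::
  "('p, 'e::euclidean_space) chart set \<Rightarrow> ('p, 'e) form1 \<Rightarrow> bool" where
  "smooth_form1 M \<alpha> \<longleftrightarrow>
     (\<forall>c\<in>M. \<forall>x\<in>chart_image c. linear (\<alpha> c x)) \<and>
     (\<forall>c\<in>M. \<forall>v. smooth_on (chart_image c) (\<lambda>x. \<alpha> c x v)) \<and>
     (\<forall>c\<in>M. \<forall>c'\<in>M. \<forall>p\<in>fst c \<inter> fst c'. \<forall>v.
        \<alpha> c (snd c p) v = \<alpha> c' (snd c' p) (dtransition c c' p v))"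

definition type_1_0 ::
  "('p, 'e::euclidean_space) chart set \<Rightarrow> ('p, 'e) endo_field \<Rightarrow> ('p, 'e) form1 \<Rightarrow> bool" where
  "type_1_0 M J \<alpha> \<longleftrightarrow>
     (\<forall>c\<in>M. \<forall>x\<in>chart_image c. \<forall>v. \<alpha> c x (J c x v) = \<i> * \<alpha> c x v)"

text \<open>Integrability: \<open>J\<close> is induced by local complex coordinates \<open>h\<close>, that is,
  \<open>dh \<circ> J = \<i> dh\<close>.\<close>

definition integrable_acs ::
  "('p, complex^'n) chart set \<Rightarrow> ('p, complex^'n) endo_field \<Rightarrow> bool" where
  "integrable_acs M J \<longleftrightarrow>
     (\<forall>c\<in>M. \<forall>x\<in>chart_image c. \<exists>V (h :: complex^'n \<Rightarrow> complex^'n).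
        open V \<and> x \<in> V \<and> V \<subseteq> chart_image c \<and>
        smooth_on V h \<and> inj_on h V \<and> open (h ` V) \<and> smooth_on (h ` V) (inv_into V h) \<and>
        (\<forall>y\<in>V. \<forall>v. frechet_derivative h (at y) (J c y v)
                     = \<i> *s frechet_derivative h (at y) v))"

section \<open>The operator mu-bar and the rank of the Nijenhuis tensor\<close>

definition ext_deriv ::
  "('e::euclidean_space \<Rightarrow> 'e \<Rightarrow> complex) \<Rightarrow> 'e \<Rightarrow> 'e \<Rightarrow> 'e \<Rightarrow> complex" where
  "ext_deriv a x u v =
     frechet_derivative (\<lambda>y. a y v) (at x) u - frechet_derivative (\<lambda>y. a y u) (at x) v"

text \<open>The \<open>(0,2)\<close>-part of a complex 2-form \<open>\<beta>\<close> on a vector space with complex structure \<open>j\<close>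
  is \<open>\<beta>(P u, P v)\<close>, where \<open>\<beta>\<close> is extended complex bilinearly to the complexification and
  \<open>P u = (u + \<i> j u) / 2\<close> is the projection onto the vectors of type \<open>(0,1)\<close>; this is expanded below.\<close>

definition proj_0_2 ::
  "('e::euclidean_space \<Rightarrow> 'e) \<Rightarrow> ('e \<Rightarrow> 'e \<Rightarrow> complex) \<Rightarrow> 'e \<Rightarrow> 'e \<Rightarrow> complex" where
  "proj_0_2 j \<beta> u v = (\<beta> u v + \<i> * \<beta> (j u) v + \<i> * \<beta> u (j v) - \<beta> (j u) (j v)) / 4"

definition mubar ::
  "('p, 'e::euclidean_space) endo_field \<Rightarrow> ('p, 'e) form1 \<Rightarrow>
   ('p, 'e) chart \<Rightarrow> 'e \<Rightarrow> 'e \<Rightarrow> 'e \<Rightarrow> complex" where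
  "mubar J \<alpha> c x = proj_0_2 (J c x) (ext_deriv (\<alpha> c) x)"

definition form2_scale ::
  "complex \<Rightarrow> ('e \<Rightarrow> 'e \<Rightarrow> complex) \<Rightarrow> 'e \<Rightarrow> 'e \<Rightarrow> complex" where
  "form2_scale a \<beta> = (\<lambda>u v. a * \<beta> u v)"

lemma vector_space_form2_scale: "vector_space form2_scale"
  by unfold_locales (auto simp: form2_scale_def fun_eq_iff algebra_simps)

text \<open>The value of \<open>mubar J \<alpha>\<close> at a point depends only on the value of \<open>\<alpha>\<close> there, and every
  \<open>(1,0)\<close>-covector extends to a smooth \<open>(1,0)\<close>-form. So the set below is the image of the map
  that \<open>mubar\<close> induces from \<open>(1,0)\<close>-covectors to \<open>(0,2)\<close>-covectors at the point.\<close>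

definition nijenhuis_rank ::
  "('p, 'e::euclidean_space) chart set \<Rightarrow> ('p, 'e) endo_field \<Rightarrow> ('p, 'e) chart \<Rightarrow> 'e \<Rightarrow> nat" where
  "nijenhuis_rank M J c x =
     vector_space.dim form2_scale {mubar J \<alpha> c x | \<alpha>. smooth_form1 M \<alpha> \<and> type_1_0 M J \<alpha>}"

definition constant_rank ::
  "('p, 'e::euclidean_space) chart set \<Rightarrow> ('p, 'e) endo_field \<Rightarrow> nat \<Rightarrow> bool" where
  "constant_rank M J k \<longleftrightarrow> (\<forall>c\<in>M. \<forall>x\<in>chart_image c. nijenhuis_rank M J c x = k)"

section \<open>Curves of almost complex structures on 6-manifolds\<close>

text \<open>Pointwise complex linear independence of three 1-forms and their conjugates.\<close>

definition independent_with_conj ::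
  "('p, 'e::euclidean_space) chart set \<Rightarrow> (3 \<Rightarrow> ('p, 'e) form1) \<Rightarrow> bool" where
  "independent_with_conj M \<omega> \<longleftrightarrow>
     (\<forall>c\<in>M. \<forall>x\<in>chart_image c. \<forall>a b :: 3 \<Rightarrow> complex.
        (\<forall>v. (\<Sum>j\<in>UNIV. a j * \<omega> j c x v + b j * cnj (\<omega> j c x v)) = 0) \<longrightarrow>
        (\<forall>j. a j = 0 \<and> b j = 0))"

definition coframe_1_0 ::
  "('p, 'e::euclidean_space) chart set \<Rightarrow> ('p, 'e) endo_field \<Rightarrow> (3 \<Rightarrow> ('p, 'e) form1) \<Rightarrow> bool" where
  "coframe_1_0 M J \<phi> \<longleftrightarrow>
     (\<forall>j. smooth_form1 M (\<phi> j) \<and> type_1_0 M J (\<phi> j)) \<and> independent_with_conj M \<phi>"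

definition deformed_coframe ::
  "(3 \<Rightarrow> ('p, 'e) form1) \<Rightarrow> (3 \<Rightarrow> 3 \<Rightarrow> 'p \<Rightarrow> complex) \<Rightarrow> complex \<Rightarrow> 3 \<Rightarrow> ('p, 'e) form1" where
  "deformed_coframe \<phi> f s j =
     (\<lambda>c x v. \<phi> j c x v + s * (\<Sum>k\<in>UNIV. f j k (chart_inv c x) * cnj (\<phi> k c x v)))"

text \<open>\<open>J s\<close> is the almost complex structure defined by the deformed coframe: the unique one for
  which these forms are of type \<open>(1,0)\<close>.\<close>

definition acs_curve ::
  "('p, 'e::euclidean_space) chart set \<Rightarrow> ('p, 'e) endo_field \<Rightarrow> real \<Rightarrow>
   (complex \<Rightarrow> ('p, 'e) endo_field) \<Rightarrow> bool" where
  "acs_curve M J\<^sub>0 \<epsilon> J \<longleftrightarrow>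
     J 0 = J\<^sub>0 \<and>
     (\<exists>\<phi> f. coframe_1_0 M J\<^sub>0 \<phi> \<and>
        (\<forall>j k. smooth_function M (f j k)) \<and>
        (\<forall>s. norm s < \<epsilon> \<longrightarrow>
           almost_complex_structure M (J s) \<and>
           independent_with_conj M (deformed_coframe \<phi> f s) \<and>
           (\<forall>j. type_1_0 M (J s) (deformed_coframe \<phi> f s j))))"

section \<open>The \<open>C\<^sup>0\<close> topology\<close>

text \<open>Uniform convergence of the components on compact subsets of chart images; on a compact
  manifold this is uniform convergence for any Riemannian metric.\<close>

definition C0_topology ::
  "('p, 'e::euclidean_space) chart set \<Rightarrow> ('p, 'e) endo_field topology" where
  "C0_topology M = topology_generated_by
     {{J. almost_complex_structure M J \<and> (\<forall>x\<in>K. onorm (\<lambda>v. J c x v - J\<^sub>1 c x v) < \<delta>)}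
      | J\<^sub>1 c K \<delta>. almost_complex_structure M J\<^sub>1 \<and> c \<in> M \<and>
          compact K \<and> K \<subseteq> chart_image c \<and> (0::real) < \<delta>}"

section \<open>The torus, the Iwasawa manifold and the Nakamura manifolds\<close>

text \<open>The smooth structure on the image of \<open>q\<close> for which \<open>q\<close> is a local diffeomorphism: the charts are
  the local inverses of \<open>q\<close>.\<close>

definition quotient_atlas :: "('e::euclidean_space \<Rightarrow> 'p) \<Rightarrow> ('p, 'e) chart set" where
  "quotient_atlas q = {(q ` V, inv_into V q) | V. open V \<and> inj_on q V}"

definition gauss_ints :: "complex set" where
  "gauss_ints = {z. Re z \<in> \<int> \<and> Im z \<in> \<int>}"

definition translation_group :: "(complex^3) monoid" where
  "translation_group = \<lparr>carrier = UNIV, mult = (+), one = 0\<rparr>"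

definition torus6 :: "((complex^3) set, complex^3) chart set" where
  "torus6 = quotient_atlas (\<lambda>z. z <#\<^bsub>translation_group\<^esub> {z. \<forall>i. z $ i \<in> gauss_ints})"

text \<open>The complex Heisenberg group, in the coordinates given by the entries above the diagonal.\<close>

definition heis_matrix :: "complex^3 \<Rightarrow> complex^3^3" where
  "heis_matrix z = vector [vector [1, z$1, z$3], vector [0, 1, z$2], vector [0, 0, 1]]"

definition heisenberg_group :: "(complex^3) monoid" where
  "heisenberg_group =
     \<lparr>carrier = UNIV, mult = (\<lambda>z w. vector [z$1 + w$1, z$2 + w$2, z$3 + w$3 + z$1 * w$2]), one = 0\<rparr>"

lemma heis_matrix_mult:
  "heis_matrix (z \<otimes>\<^bsub>heisenberg_group\<^esub> w) = heis_matrix z ** heis_matrix w"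
  by (simp add: heis_matrix_def heisenberg_group_def matrix_matrix_mult_def vec_eq_iff forall_3
      sum_3 algebra_simps)

definition iwasawa_lattice :: "(complex^3) set" where
  "iwasawa_lattice =
     {z. (\<forall>i j. heis_matrix z $ i $ j \<in> gauss_ints) \<and> det (heis_matrix z) = 1}"

definition iwasawa_manifold :: "((complex^3) set, complex^3) chart set" where
  "iwasawa_manifold = quotient_atlas (\<lambda>z. z <#\<^bsub>heisenberg_group\<^esub> iwasawa_lattice)"

definition nakamura_group :: "(complex^3) monoid" where
  "nakamura_group =
     \<lparr>carrier = UNIV,
      mult = (\<lambda>z w. vector [z$1 + w$1, z$2 + exp (z$1) * w$2, z$3 + exp (- z$1) * w$3]),
      one = 0\<rparr>"

lemma group_nakamura_group: "group nakamura_group"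
proof (rule groupI)
  fix z assume "z \<in> carrier nakamura_group"
  have "vector [- z$1, - exp (- z$1) * z$2, - exp (z$1) * z$3] \<otimes>\<^bsub>nakamura_group\<^esub> z
      = \<one>\<^bsub>nakamura_group\<^esub>"
    by (simp add: nakamura_group_def vec_eq_iff forall_3)
  then show "\<exists>y\<in>carrier nakamura_group. y \<otimes>\<^bsub>nakamura_group\<^esub> z = \<one>\<^bsub>nakamura_group\<^esub>"
    by (rule bexI) (simp add: nakamura_group_def)
qed (simp_all add: nakamura_group_def vec_eq_iff forall_3 exp_add exp_minus field_simps)

text \<open>A lattice is a discrete cocompact subgroup. The forms \<open>dz\<^sub>1\<close>, \<open>exp (-z\<^sub>1) dz\<^sub>2\<close>, \<open>exp (z\<^sub>1) dz\<^sub>3\<close>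
  are left invariant, so they descend to the quotient by every lattice.\<close>

definition nakamura_lattice :: "(complex^3) set \<Rightarrow> bool" where
  "nakamura_lattice \<Gamma> \<longleftrightarrow>
     subgroup \<Gamma> nakamura_group \<and>
     discrete \<Gamma> \<and>
     (\<exists>K. compact K \<and> (\<Union>z\<in>K. \<Gamma> #>\<^bsub>nakamura_group\<^esub> z) = UNIV)"

definition nakamura_manifold :: "(complex^3) set \<Rightarrow> ((complex^3) set, complex^3) chart set" where
  "nakamura_manifold \<Gamma> = quotient_atlas (\<lambda>z. \<Gamma> #>\<^bsub>nakamura_group\<^esub> z)"

end

theory Submission
  imports Defs
begin

text \<open>All manifolds in question are quotients of \<open>\<complex>\<^sup>3\<close> by affine holomorphic maps, and \<open>J\<^sub>0\<close> is the complex
  structure inherited from \<open>\<complex>\<^sup>3\<close>. For each rank one chooses a suitable coframe \<open>\<psi>\<^sub>1, \<psi>\<^sub>2, \<psi>\<^sub>3\<close> of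
  \<open>(1,0)\<close>-forms on the quotient and deforms it by constants \<open>\<sigma> = s a\<close>, \<open>\<tau> = s b\<close> with \<open>a, b \<in> {0, 1}\<close>:
  \<open>\<omega>\<^sub>1 = \<psi>\<^sub>1 + \<sigma> cnj \<psi>\<^sub>2\<close>, \<open>\<omega>\<^sub>2 = \<psi>\<^sub>2 + \<tau> cnj \<psi>\<^sub>3\<close>, \<open>\<omega>\<^sub>3 = \<psi>\<^sub>3\<close>. The deformation is nilpotent, so these forms
  define an almost complex structure for every \<open>s\<close>, given by a polynomial in \<open>s\<close> and \<open>cnj s\<close>. In particular
  it is close to \<open>J\<^sub>0\<close> in the \<open>C\<^sup>0\<close> topology for small \<open>s\<close>.

  Modulo \<open>(1,0)\<close>-forms for the new structure, \<open>\<psi>\<^sub>1\<close> becomes \<open>- \<sigma> \<theta>\<^sub>2\<close>, \<open>\<psi>\<^sub>2\<close> becomes \<open>- \<tau> \<theta>\<^sub>3\<close>, and \<open>\<psi>\<^sub>3\<close>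
  becomes 0, where \<open>\<theta>\<^sub>k\<close> is the class of \<open>cnj \<psi>\<^sub>k\<close> and \<open>\<theta>\<^sub>1, \<theta>\<^sub>2, \<theta>\<^sub>3\<close> are independent. Hence once the
  \<open>d\<psi>\<^sub>j\<close> are written in the \<open>\<psi>\<^sub>k\<close> and their conjugates, the \<open>(0,2)\<close>-parts of the \<open>d\<omega>\<^sub>j\<close> are combinations of the
  \<open>\<theta>\<^sub>k \<and> \<theta>\<^sub>l\<close> with explicit coefficients. Since \<open>mubar\<close> is tensorial, the rank of the Nijenhuis tensor is the
  rank of the \<open>3 \<times> 3\<close> matrix of these coefficients (\<open>nijenhuis_rank_acs\<close>).

  The problem is thereby reduced to finding coframes for which that matrix has the prescribed rank at every
  point (\<open>constant_rank_deformations\<close>). On the Nakamura manifolds left invariant coframes suffice. On the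
  torus and the Iwasawa manifold the coframes also involve the nowhere vanishing periodic function
  \<open>wave\<close>, whose derivatives vanish nowhere either, so that the rank does not drop at
  any point. The coefficients and ranks are found in \<open>torus_rows\<close>, \<open>iwasawa_rows\<close>, \<open>nakamura_rows\<close> and the
  lemmas on constant rank following them.\<close>

section \<open>Smooth functions\<close>

lemma Ck_on_cong:
  assumes "open S" "\<And>x. x \<in> S \<Longrightarrow> f x = g x" "Ck_on k S f"
  shows "Ck_on k S g"
  using assms(2,3)
proof (induction k arbitrary: f g)
  case 0
  then show ?case by (simp add: continuous_on_eq)
next
  case (Suc k)
  have d: "(g has_derivative frechet_derivative f (at x)) (at x)" if "x \<in> S" for x
  proof (rule has_derivative_transform_within_open[OF _ \<open>open S\<close> that])
    show "(f has_derivative frechet_derivative f (at x)) (at x)"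
      using Suc.prems(2) that by (simp add: frechet_derivative_works)
  qed (rule Suc.prems(1))
  then have eq: "frechet_derivative g (at x) = frechet_derivative f (at x)" if "x \<in> S" for x
    using that frechet_derivative_at by metis
  have "Ck_on k S (\<lambda>x. frechet_derivative g (at x) v)" for v
  proof (rule Suc.IH)
    show "Ck_on k S (\<lambda>x. frechet_derivative f (at x) v)"
      using Suc.prems(2) by simp
  qed (simp add: eq)
  then show ?case using d unfolding Ck_on.simps differentiable_def by blast
qed

lemma Ck_on_SucI:
  assumes "open S" "\<And>x. x \<in> S \<Longrightarrow> (f has_derivative f' x) (at x)"
    "\<And>v. Ck_on k S (\<lambda>x. f' x v)"
  shows "Ck_on (Suc k) S f"
proof -
  have "frechet_derivative f (at x) = f' x" if "x \<in> S" for x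
    using assms(2)[OF that] frechet_derivative_at by metis
  then have "Ck_on k S (\<lambda>x. frechet_derivative f (at x) v)" for v
    by (intro Ck_on_cong[OF assms(1) _ assms(3)[of v]]) simp
  then show ?thesis using assms(2) unfolding Ck_on.simps differentiable_def by blast
qed

lemma Ck_on_SucD:
  assumes "Ck_on (Suc k) S f" "x \<in> S"
  shows "(f has_derivative frechet_derivative f (at x)) (at x)"
  using assms by (auto simp: frechet_derivative_works)

lemma Ck_on_Suc_imp: "Ck_on (Suc k) S f \<Longrightarrow> Ck_on k S f"
proof (induction k arbitrary: f)
  case 0
  then show ?case
    by (auto intro!: continuous_at_imp_continuous_on differentiable_imp_continuous_within)
next
  case (Suc k)
  show ?case unfolding Ck_on.simps(2)
    using Suc.IH Suc.prems Ck_on.simps(2)[of "Suc k" S f] by blast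
qed

lemma Ck_on_const: "open S \<Longrightarrow> Ck_on k S (\<lambda>_. c)"
proof (induction k arbitrary: c)
  case (Suc k)
  show ?case
    by (rule Ck_on_SucI[OF Suc.prems, where f' = "\<lambda>_ _. 0"]) (simp_all add: Suc)
qed simp

lemma Ck_on_bounded_linear:
  assumes "open S" "bounded_linear f"
  shows "Ck_on k S f"
proof (cases k)
  case 0
  then show ?thesis using assms by (simp add: linear_continuous_on)
next
  case (Suc m)
  have "(f has_derivative f) (at x)" for x
    using assms(2) by (rule bounded_linear_imp_has_derivative)
  then have "Ck_on (Suc m) S f"
    by (intro Ck_on_SucI[OF assms(1), where f' = "\<lambda>_. f"] Ck_on_const[OF assms(1)])
  then show ?thesis
    unfolding Suc .
qed

lemma Ck_on_add:
  "open S \<Longrightarrow> Ck_on k S f \<Longrightarrow> Ck_on k S g \<Longrightarrow> Ck_on k S (\<lambda>x. f x + g x)"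
proof (induction k arbitrary: f g)
  case (Suc k)
  show ?case
  proof (rule Ck_on_SucI[OF Suc.prems(1)])
    show "((\<lambda>x. f x + g x) has_derivative
        (\<lambda>v. frechet_derivative f (at x) v + frechet_derivative g (at x) v)) (at x)" if "x \<in> S" for x
      by (intro has_derivative_add Ck_on_SucD[OF Suc.prems(2) that] Ck_on_SucD[OF Suc.prems(3) that])
    show "Ck_on k S (\<lambda>x. frechet_derivative f (at x) v + frechet_derivative g (at x) v)" for v
      using Suc by simp
  qed
qed (auto intro: continuous_on_add)

text \<open>The Leibniz rule turns one derivative of a product into products of functions that are
  \<open>C\<^sup>k\<close>, so the induction hypothesis must cover all pairs of factors.\<close>

lemma (in bounded_bilinear) Ck_on_prod:
  "open S \<Longrightarrow> Ck_on k S f \<Longrightarrow> Ck_on k S g \<Longrightarrow> Ck_on k S (\<lambda>x. prod (f x) (g x))"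
proof (induction k arbitrary: f g)
  case (Suc k)
  show ?case
  proof (rule Ck_on_SucI[OF Suc.prems(1)])
    show "((\<lambda>x. prod (f x) (g x)) has_derivative
        (\<lambda>v. prod (f x) (frechet_derivative g (at x) v) + prod (frechet_derivative f (at x) v) (g x)))
        (at x)" if "x \<in> S" for x
      by (intro FDERIV Ck_on_SucD[OF Suc.prems(2) that] Ck_on_SucD[OF Suc.prems(3) that])
    have "Ck_on k S f" "Ck_on k S g"
      using Suc.prems Ck_on_Suc_imp by blast+
    then show "Ck_on k S (\<lambda>x. prod (f x) (frechet_derivative g (at x) v) +
        prod (frechet_derivative f (at x) v) (g x))" for v
      using Suc by (intro Ck_on_add) auto
  qed
qed (auto intro: continuous_on)

lemma Ck_on_compose_linear:
  assumes "open S" "bounded_linear h" "Ck_on k S f"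
  shows "Ck_on k S (\<lambda>x. h (f x))"
  using assms(3)
proof (induction k arbitrary: f)
  case 0
  then show ?case using assms(2) by (simp add: bounded_linear.continuous_on)
next
  case (Suc k)
  show ?case
  proof (rule Ck_on_SucI[OF assms(1)])
    show "((\<lambda>x. h (f x)) has_derivative (\<lambda>v. h (frechet_derivative f (at x) v))) (at x)"
      if "x \<in> S" for x
      using Ck_on_SucD[OF Suc.prems that] by (rule bounded_linear.has_derivative[OF assms(2)])
    show "Ck_on k S (\<lambda>x. h (frechet_derivative f (at x) v))" for v
      using Suc by simp
  qed
qed

lemma Ck_on_exp:
  fixes f :: "'a::real_normed_vector \<Rightarrow> complex"
  shows "open S \<Longrightarrow> Ck_on k S f \<Longrightarrow> Ck_on k S (\<lambda>x. exp (f x))"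
proof (induction k)
  case (Suc k)
  show ?case
  proof (rule Ck_on_SucI[OF Suc.prems(1)])
    show "((\<lambda>x. exp (f x)) has_derivative (\<lambda>v. exp (f x) * frechet_derivative f (at x) v)) (at x)"
      if "x \<in> S" for x
      using has_derivative_compose[OF Ck_on_SucD[OF Suc.prems(2) that], of exp "\<lambda>w. exp (f x) * w"]
      by (simp add: DERIV_exp has_field_derivative_imp_has_derivative)
    have "Ck_on k S (\<lambda>x. exp (f x))"
      using Suc Ck_on_Suc_imp by blast
    then show "Ck_on k S (\<lambda>x. exp (f x) * frechet_derivative f (at x) v)" for v
      using Suc by (intro bounded_bilinear.Ck_on_prod[OF bounded_bilinear_mult]) auto
  qed
qed (auto intro: continuous_on_exp)

text \<open>The closure properties pass from \<open>Ck_on\<close> to \<open>smooth_on\<close>; together they cover every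
  expression in coordinates, their conjugates and exponentials.\<close>

lemma smooth_on_cong:
  "open S \<Longrightarrow> (\<And>x. x \<in> S \<Longrightarrow> f x = g x) \<Longrightarrow> smooth_on S f \<Longrightarrow> smooth_on S g"
  unfolding smooth_on_def by (meson Ck_on_cong)

lemma smooth_on_const: "open S \<Longrightarrow> smooth_on S (\<lambda>_. c)"
  by (simp add: smooth_on_def Ck_on_const)

lemma smooth_on_bounded_linear: "open S \<Longrightarrow> bounded_linear f \<Longrightarrow> smooth_on S f"
  by (simp add: smooth_on_def Ck_on_bounded_linear)

lemma smooth_on_add:
  "open S \<Longrightarrow> smooth_on S f \<Longrightarrow> smooth_on S g \<Longrightarrow> smooth_on S (\<lambda>x. f x + g x)"
  by (simp add: smooth_on_def Ck_on_add)

lemma smooth_on_mult: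
  fixes f g :: "'a::real_normed_vector \<Rightarrow> complex"
  shows "open S \<Longrightarrow> smooth_on S f \<Longrightarrow> smooth_on S g \<Longrightarrow> smooth_on S (\<lambda>x. f x * g x)"
  by (simp add: smooth_on_def bounded_bilinear.Ck_on_prod[OF bounded_bilinear_mult])

lemma smooth_on_compose_linear:
  "open S \<Longrightarrow> bounded_linear h \<Longrightarrow> smooth_on S f \<Longrightarrow> smooth_on S (\<lambda>x. h (f x))"
  by (simp add: smooth_on_def Ck_on_compose_linear)

lemma smooth_on_cnj: "open S \<Longrightarrow> smooth_on S f \<Longrightarrow> smooth_on S (\<lambda>x. cnj (f x))"
  by (rule smooth_on_compose_linear[OF _ bounded_linear_cnj])

lemma smooth_on_minus:
  "open S \<Longrightarrow> smooth_on S f \<Longrightarrow> smooth_on S (\<lambda>x. - f x)"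
  by (rule smooth_on_compose_linear[OF _ bounded_linear_minus[OF bounded_linear_ident]])

lemma smooth_on_diff:
  "open S \<Longrightarrow> smooth_on S f \<Longrightarrow> smooth_on S g \<Longrightarrow> smooth_on S (\<lambda>x. f x - g x)"
  using smooth_on_add[of S f "\<lambda>x. - g x"] by (simp add: smooth_on_minus)

lemma smooth_on_exp:
  fixes f :: "'a::real_normed_vector \<Rightarrow> complex"
  shows "open S \<Longrightarrow> smooth_on S f \<Longrightarrow> smooth_on S (\<lambda>x. exp (f x))"
  by (simp add: smooth_on_def Ck_on_exp)

lemma smooth_on_sum:
  "open S \<Longrightarrow> (\<And>i. i \<in> I \<Longrightarrow> smooth_on S (f i)) \<Longrightarrow> smooth_on S (\<lambda>x. \<Sum>i\<in>I. f i x)"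
  by (induction I rule: infinite_finite_induct) (auto simp: smooth_on_const intro: smooth_on_add)

lemma smooth_on_nth: "open S \<Longrightarrow> smooth_on S (\<lambda>z. z $ i)"
  by (rule smooth_on_bounded_linear[OF _ bounded_linear_vec_nth])

lemma smooth_on_vec:
  fixes f :: "'a::real_normed_vector \<Rightarrow> complex^'n"
  assumes "open S" "\<And>i. smooth_on S (\<lambda>x. f x $ i)"
  shows "smooth_on S f"
proof -
  have "bounded_linear (\<lambda>w. axis i w :: complex^'n)" for i
    unfolding linear_conv_bounded_linear[symmetric]
    by (auto simp: linear_iff axis_def vec_eq_iff)
  then have "smooth_on S (\<lambda>x. axis i (f x $ i) :: complex^'n)" for i
    by (rule smooth_on_compose_linear[OF assms(1) _ assms(2)])
  then have "smooth_on S (\<lambda>x. \<Sum>i\<in>UNIV. axis i (f x $ i))"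
    by (intro smooth_on_sum assms(1))
  moreover have "(\<Sum>i\<in>UNIV. axis i (f x $ i)) = f x" for x
    by (simp add: vec_eq_iff axis_def)
  ultimately show ?thesis by simp
qed

lemmas smooth_on_intros = smooth_on_const smooth_on_add smooth_on_mult smooth_on_cnj
  smooth_on_minus smooth_on_diff smooth_on_exp smooth_on_sum smooth_on_nth

lemma smooth_on_subset: "smooth_on T f \<Longrightarrow> S \<subseteq> T \<Longrightarrow> smooth_on S f"
proof -
  have "Ck_on k T f \<Longrightarrow> S \<subseteq> T \<Longrightarrow> Ck_on k S f" for k
    by (induction k arbitrary: f) (auto intro: continuous_on_subset)
  then show "smooth_on T f \<Longrightarrow> S \<subseteq> T \<Longrightarrow> smooth_on S f"
    by (auto simp: smooth_on_def)
qed

lemma smooth_on_continuous: "smooth_on S f \<Longrightarrow> continuous_on S f"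
  unfolding smooth_on_def using Ck_on.simps(1) by blast

lemma smooth_on_has_derivative:
  "smooth_on S f \<Longrightarrow> x \<in> S \<Longrightarrow> (f has_derivative frechet_derivative f (at x)) (at x)"
  unfolding smooth_on_def using Ck_on_SucD by blast

lemma ext_deriv_eq:
  assumes "\<And>v. ((\<lambda>y. \<alpha> y v) has_derivative \<alpha>' v) (at x)"
  shows "ext_deriv \<alpha> x u v = \<alpha>' v u - \<alpha>' u v"
  using assms frechet_derivative_at unfolding ext_deriv_def by metis

section \<open>A nilpotent deformation of the complex structure on \<open>\<complex>\<^sup>3\<close>\<close>

text \<open>In a coframe \<open>\<psi>\<close> of \<open>(1,0)\<close>-forms for the standard complex structure, the deformations used below
  are \<open>\<omega>\<^sub>1 = \<psi>\<^sub>1 + \<sigma> cnj \<psi>\<^sub>2\<close>, \<open>\<omega>\<^sub>2 = \<psi>\<^sub>2 + \<tau> cnj \<psi>\<^sub>3\<close>, \<open>\<omega>\<^sub>3 = \<psi>\<^sub>3\<close>. With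
  \<open>S w = (\<sigma> cnj w\<^sub>2, \<tau> cnj w\<^sub>3, 0)\<close> this is \<open>\<omega> = (1 + S) \<psi>\<close>. The conjugate linear map \<open>S\<close> satisfies
  \<open>S\<^sup>3 = 0\<close>, so \<open>1 + S\<close> has the polynomial inverse \<open>1 - S + S\<^sup>2\<close>, for every \<open>\<sigma>\<close> and \<open>\<tau>\<close>.\<close>

definition shear :: "complex \<Rightarrow> complex \<Rightarrow> complex^3 \<Rightarrow> complex^3" where
  "shear \<sigma> \<tau> w = vector [w$1 + \<sigma> * cnj (w$2), w$2 + \<tau> * cnj (w$3), w$3]"

definition unshear :: "complex \<Rightarrow> complex \<Rightarrow> complex^3 \<Rightarrow> complex^3" where
  "unshear \<sigma> \<tau> w = vector [w$1 - \<sigma> * cnj (w$2) + \<sigma> * cnj \<tau> * w$3, w$2 - \<tau> * cnj (w$3), w$3]"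

text \<open>The complex structure on \<open>\<complex>\<^sup>3\<close> for which the components of \<open>shear \<sigma> \<tau>\<close> are complex linear.\<close>

definition sheared_i :: "complex \<Rightarrow> complex \<Rightarrow> complex^3 \<Rightarrow> complex^3" where
  "sheared_i \<sigma> \<tau> w = unshear \<sigma> \<tau> (\<i> *s shear \<sigma> \<tau> w)"

lemma unshear_shear [simp]: "unshear \<sigma> \<tau> (shear \<sigma> \<tau> w) = w"
  by (simp add: shear_def unshear_def vec_eq_iff forall_3 algebra_simps)

lemma shear_unshear [simp]: "shear \<sigma> \<tau> (unshear \<sigma> \<tau> w) = w"
  by (simp add: shear_def unshear_def vec_eq_iff forall_3 algebra_simps)

lemma linear_shear: "linear (shear \<sigma> \<tau>)"
  by (simp add: linear_iff shear_def vec_eq_iff forall_3 algebra_simps scaleR_conv_of_real[where 'a=complex])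

lemma linear_unshear: "linear (unshear \<sigma> \<tau>)"
  by (simp add: linear_iff unshear_def vec_eq_iff forall_3 algebra_simps scaleR_conv_of_real[where 'a=complex])

lemma linear_vector_smult: "linear (\<lambda>w :: complex^'n. c *s w)"
  by (simp add: linear_iff vec_eq_iff algebra_simps)

lemma linear_sheared_i: "linear (sheared_i \<sigma> \<tau>)"
  using linear_compose[OF linear_compose[OF linear_shear linear_vector_smult] linear_unshear]
  by (simp add: sheared_i_def[abs_def] comp_def)

lemma shear_sheared_i: "shear \<sigma> \<tau> (sheared_i \<sigma> \<tau> w) = \<i> *s shear \<sigma> \<tau> w"
  by (simp add: sheared_i_def)

lemma sheared_i_sheared_i: "sheared_i \<sigma> \<tau> (sheared_i \<sigma> \<tau> w) = - w"
proof -
  have "sheared_i \<sigma> \<tau> (sheared_i \<sigma> \<tau> w) = unshear \<sigma> \<tau> (- shear \<sigma> \<tau> w)"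
    by (simp add: sheared_i_def vector_smult_assoc)
  then show ?thesis
    by (simp add: linear_neg[OF linear_unshear])
qed

lemma shear_0 [simp]: "shear 0 0 w = w"
  by (simp add: shear_def vec_eq_iff forall_3)

lemma sheared_i_0 [simp]: "sheared_i 0 0 w = \<i> *s w"
  by (simp add: sheared_i_def unshear_def vec_eq_iff forall_3)

lemma linear_matrix_vector: "linear (\<lambda>v. (A :: complex^'n^'m) *v v)"
  by (simp add: linear_iff vec_eq_iff matrix_vector_mult_def sum.distrib algebra_simps
      scaleR_sum_right)

section \<open>Deforming an invariant coframe on a quotient of \<open>\<complex>\<^sup>3\<close>\<close>

lemma quotient_atlas_chart:
  assumes "c \<in> quotient_atlas q"
  shows "open (chart_image c)" "fst c = q ` chart_image c"
    "\<And>x. x \<in> chart_image c \<Longrightarrow> chart_inv c x = q x"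
    "\<And>x. x \<in> chart_image c \<Longrightarrow> snd c (q x) = x"
proof -
  obtain V where V: "open V" "inj_on q V" "c = (q ` V, inv_into V q)"
    using assms by (auto simp: quotient_atlas_def)
  have im: "chart_image c = V"
    using V by (force simp: chart_image_def)
  show "open (chart_image c)" "fst c = q ` chart_image c"
    unfolding im using V by simp_all
  show snd: "snd c (q x) = x" if "x \<in> chart_image c" for x
    using V that unfolding im by simp
  show "chart_inv c x = q x" if "x \<in> chart_image c" for x
  proof -
    have "inv_into (q ` V) (inv_into V q) (inv_into V q (q x)) = q x"
      using V(2) that im by (intro inv_into_f_f) (auto intro: inj_on_inv_into)
    then show ?thesis
      using V that unfolding im by (simp add: chart_inv_def)
  qed
qed

text \<open>A coframe \<open>\<psi>\<^sub>j = \<Sum>\<^sub>m A\<^sub>j\<^sub>m dz\<^sub>m\<close> on \<open>\<complex>\<^sup>3\<close> with dual frame \<open>B\<close>, invariant under enough maps \<open>T\<close> over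
  the identity of the quotient to relate any two points of a fibre of \<open>q\<close>. Such a coframe descends to the
  quotient, and its components in a chart are those on \<open>\<complex>\<^sup>3\<close>.\<close>

locale invariant_coframe =
  fixes q :: "complex^3 \<Rightarrow> 'p" and A B :: "complex^3 \<Rightarrow> complex^3^3"
  assumes A_B: "A z ** B z = mat 1" and B_A: "B z ** A z = mat 1"
    and smooth_A: "smooth_on UNIV (\<lambda>z. A z $ i $ j)"
    and smooth_B: "smooth_on UNIV (\<lambda>z. B z $ i $ j)"
    and deck: "q z = q w \<Longrightarrow> \<exists>T T'. T z = w \<and> (\<forall>y. q (T y) = q y) \<and>
      (\<forall>y. (T has_derivative T' y) (at y)) \<and> (\<forall>y v. A (T y) *v T' y v = A y *v v)"
begin

abbreviation M :: "('p, complex^3) chart set" where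
  "M \<equiv> quotient_atlas q"

lemma A_B_vec [simp]: "A z *v (B z *v v) = v" and B_A_vec [simp]: "B z *v (A z *v v) = v"
  by (simp_all add: matrix_vector_mul_assoc A_B B_A)

lemma smooth_on_A:
  assumes "open S"
  shows "smooth_on S (\<lambda>x. A x *v v)"
proof (rule smooth_on_vec[OF assms])
  fix i
  have "smooth_on S (\<lambda>x. A x $ i $ j)" for j
    by (rule smooth_on_subset[OF smooth_A]) simp
  then show "smooth_on S (\<lambda>x. (A x *v v) $ i)"
    unfolding matrix_vector_mult_def by (simp add: smooth_on_intros assms)
qed

lemma smooth_on_B:
  assumes "open S" "smooth_on S w"
  shows "smooth_on S (\<lambda>x. B x *v w x)"
proof (rule smooth_on_vec[OF assms(1)])
  fix i
  have "smooth_on S (\<lambda>x. B x $ i $ j)" for j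
    by (rule smooth_on_subset[OF smooth_B]) simp
  moreover have "smooth_on S (\<lambda>x. w x $ j)" for j
    by (rule smooth_on_compose_linear[OF assms(1) bounded_linear_vec_nth assms(2)])
  ultimately show "smooth_on S (\<lambda>x. (B x *v w x) $ i)"
    unfolding matrix_vector_mult_def by (simp add: smooth_on_intros assms)
qed

text \<open>Near a given point a coordinate change coincides with some \<open>T\<close> from the invariance condition: if \<open>T\<close>
  maps the point into the range of the second chart, it does so for nearby points, and \<open>q\<close> is injective
  on that range.\<close>

lemma A_dtransition:
  assumes "c \<in> M" "c' \<in> M" "p \<in> fst c \<inter> fst c'"
  shows "A (snd c' p) *v dtransition c c' p v = A (snd c p) *v v"
proof -
  note C = quotient_atlas_chart[OF assms(1)] and C' = quotient_atlas_chart[OF assms(2)]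
  obtain x x' where x: "x \<in> chart_image c" "q x = p" and x': "x' \<in> chart_image c'" "q x' = p"
    using assms(3) C(2) C'(2) by auto
  obtain T T' where T: "T x = x'" "\<And>y. q (T y) = q y"
      "\<And>y. (T has_derivative T' y) (at y)" "\<And>y v. A (T y) *v T' y v = A y *v v"
    using deck[of x x'] x x' by auto
  have "continuous_on UNIV T"
    using T(3) by (intro continuous_at_imp_continuous_on) (auto intro: has_derivative_continuous)
  then have op: "open (T -` chart_image c' \<inter> chart_image c)"
    using C(1) C'(1) by (intro open_Int) (auto simp: continuous_on_open_vimage)
  have "(transition c c' has_derivative T' x) (at x)"
  proof (rule has_derivative_transform_within_open[OF T(3) op])
    show "x \<in> T -` chart_image c' \<inter> chart_image c"
      using x x' T(1) by auto
    fix y assume y: "y \<in> T -` chart_image c' \<inter> chart_image c"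
    then have "transition c c' y = snd c' (q (T y))"
      by (simp add: transition_def C(3) T(2))
    then show "T y = transition c c' y"
      using y C'(4) by auto
  qed
  then have "dtransition c c' p = T' x"
    using x C(4) by (auto simp: dtransition_def intro!: frechet_derivative_at[symmetric])
  then show ?thesis
    using T(1) T(4)[of x] x x' C(4)[OF x(1)] C'(4)[OF x'(1)] by simp
qed

lemma smooth_form1_A:
  assumes "linear h"
  shows "smooth_form1 M (\<lambda>c x v. h (A x *v v))"
  unfolding smooth_form1_def
proof (intro conjI ballI allI)
  fix c x assume "c \<in> M"
  show "linear (\<lambda>v. h (A x *v v))"
    using linear_compose[OF linear_matrix_vector assms] by (simp add: comp_def)
  show "smooth_on (chart_image c) (\<lambda>x. h (A x *v v))" for v
    using assms quotient_atlas_chart(1)[OF \<open>c \<in> M\<close>]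
    by (intro smooth_on_compose_linear[of _ h] smooth_on_A) (simp_all add: linear_conv_bounded_linear)
  show "h (A (snd c p) *v v) = h (A (snd c' p) *v dtransition c c' p v)"
    if "c' \<in> M" "p \<in> fst c \<inter> fst c'" for c' p v
    using A_dtransition[OF \<open>c \<in> M\<close> that] by simp
qed

text \<open>The forms \<open>\<omega>\<^sub>j\<close> and the structure \<open>acs \<sigma> \<tau>\<close> arise from complex coordinates on each tangent space:
  \<open>shear \<sigma> \<tau> (A x *v v)\<close> is the coordinate vector of \<open>v\<close>, and \<open>acs \<sigma> \<tau>\<close> is multiplication by \<open>\<i>\<close>.\<close>

definition acs :: "complex \<Rightarrow> complex \<Rightarrow> ('p, complex^3) endo_field" where
  "acs \<sigma> \<tau> c x v =
     (if c \<in> M \<and> x \<in> chart_image c then B x *v sheared_i \<sigma> \<tau> (A x *v v) else 0)"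

definition \<omega> :: "complex \<Rightarrow> complex \<Rightarrow> 3 \<Rightarrow> ('p, complex^3) form1" where
  "\<omega> \<sigma> \<tau> j c x v = shear \<sigma> \<tau> (A x *v v) $ j"

lemma almost_complex_structure_acs: "almost_complex_structure M (acs \<sigma> \<tau>)"
  unfolding almost_complex_structure_def
proof (intro conjI ballI allI impI)
  fix c v assume c: "c \<in> M"
  note C = quotient_atlas_chart[OF c]
  show "linear (acs \<sigma> \<tau> c x)" if "x \<in> chart_image c" for x
  proof -
    have "linear (\<lambda>v. B x *v sheared_i \<sigma> \<tau> (A x *v v))"
      using linear_compose[OF linear_compose[OF linear_matrix_vector linear_sheared_i]
          linear_matrix_vector] by (simp add: comp_def)
    then show ?thesis using c that by (simp add: acs_def[abs_def])
  qed
  show "acs \<sigma> \<tau> c x (acs \<sigma> \<tau> c x v) = - v" if "x \<in> chart_image c" for x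
    using c that
    by (simp add: acs_def sheared_i_sheared_i linear_neg[OF linear_matrix_vector])
  have "smooth_on (chart_image c) (\<lambda>x. B x *v sheared_i \<sigma> \<tau> (A x *v v))"
    using C(1) by (intro smooth_on_B smooth_on_compose_linear[of _ "sheared_i \<sigma> \<tau>"] smooth_on_A)
      (simp_all add: linear_sheared_i flip: linear_conv_bounded_linear)
  then show "smooth_on (chart_image c) (\<lambda>x. acs \<sigma> \<tau> c x v)"
    by (rule smooth_on_cong[OF C(1), rotated]) (simp add: acs_def c)
  fix c' p assume c': "c' \<in> M" and p: "p \<in> fst c \<inter> fst c'"
  let ?L = "dtransition c c' p" and ?x = "snd c p" and ?x' = "snd c' p"
  have x: "?x \<in> chart_image c" "?x' \<in> chart_image c'"
    using p by (auto simp: chart_image_def)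
  have L: "?L u = B ?x' *v (A ?x *v u)" for u
    using A_dtransition[OF c c' p, of u] by (metis B_A_vec)
  show "?L (acs \<sigma> \<tau> c ?x v) = acs \<sigma> \<tau> c' ?x' (?L v)"
    using c c' x by (simp add: L acs_def)
qed (auto simp: acs_def)

lemma smooth_form1_\<omega>: "smooth_form1 M (\<omega> \<sigma> \<tau> j)"
proof -
  have "linear (\<lambda>w. shear \<sigma> \<tau> w $ j)"
    using linear_compose[OF linear_shear bounded_linear.linear[OF bounded_linear_vec_nth]] by (simp add: comp_def)
  from smooth_form1_A[OF this] show ?thesis
    by (simp add: \<omega>_def[abs_def])
qed

lemma type_1_0_\<omega>: "type_1_0 M (acs \<sigma> \<tau>) (\<omega> \<sigma> \<tau> j)"
  by (simp add: type_1_0_def \<omega>_def acs_def shear_sheared_i)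

lemma independent_with_conj_\<omega>: "independent_with_conj M (\<omega> \<sigma> \<tau>)"
  unfolding independent_with_conj_def
proof (intro ballI allI impI)
  fix c x and a b :: "3 \<Rightarrow> complex" and j :: 3
  assume *: "\<forall>v. (\<Sum>j\<in>UNIV. a j * \<omega> \<sigma> \<tau> j c x v + b j * cnj (\<omega> \<sigma> \<tau> j c x v)) = 0"
  have w: "(\<Sum>j\<in>UNIV. a j * w $ j + b j * cnj (w $ j)) = 0" for w :: "complex^3"
    using *[rule_format, of "B x *v unshear \<sigma> \<tau> w"] by (simp add: \<omega>_def)
  have single: "(\<Sum>i\<in>UNIV. a i * axis j z $ i + b i * cnj (axis j z $ i)) = a j * z + b j * cnj z"
    for z by (subst sum.remove[of _ j]) (simp_all add: axis_def)
  have "a j + b j = 0" "\<i> * (a j - b j) = 0"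
    using w[of "axis j 1"] w[of "axis j \<i>"] single[of 1] single[of \<i>] by (simp_all add: algebra_simps)
  then show "a j = 0 \<and> b j = 0"
    by (auto simp: complex_eq_iff)
qed

lemma acs_0: "acs 0 0 = (\<lambda>c x v. if c \<in> M \<and> x \<in> chart_image c then \<i> *s v else 0)"
  by (auto simp: acs_def fun_eq_iff vector_scalar_commute)

lemma acs_curve_acs: "acs_curve M (acs 0 0) \<epsilon> (\<lambda>s. acs (s * a) (s * b))"
proof -
  define f :: "3 \<Rightarrow> 3 \<Rightarrow> 'p \<Rightarrow> complex"
    where "f = (\<lambda>j k _. if j = 1 \<and> k = 2 then a else if j = 2 \<and> k = 3 then b else 0)"
  have deformed: "deformed_coframe (\<omega> 0 0) f s j = \<omega> (s * a) (s * b) j" for s j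
  proof (intro ext)
    fix c x v
    show "deformed_coframe (\<omega> 0 0) f s j c x v = \<omega> (s * a) (s * b) j c x v"
      using exhaust_3[of j]
      by (auto simp: deformed_coframe_def \<omega>_def f_def sum_3 shear_def)
  qed
  have "coframe_1_0 M (acs 0 0) (\<omega> 0 0)"
    unfolding coframe_1_0_def
    using smooth_form1_\<omega> type_1_0_\<omega> independent_with_conj_\<omega> by blast
  moreover have "smooth_function M (f j k)" for j k
    unfolding smooth_function_def comp_def f_def
    using quotient_atlas_chart(1) smooth_on_const by blast
  ultimately show ?thesis
    unfolding acs_curve_def
    using almost_complex_structure_acs independent_with_conj_\<omega> type_1_0_\<omega> deformed
    by (intro conjI exI[of _ "\<omega> 0 0"] exI[of _ f]) (auto simp: deformed[abs_def])
qed

end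

text \<open>The coordinates of \<open>\<complex>\<^sup>n\<close> are themselves holomorphic coordinates for the standard structure.\<close>

lemma integrable_acs_standard:
  fixes q :: "complex^'n \<Rightarrow> 'p"
  assumes "J\<^sub>0 = (\<lambda>c x v. if c \<in> quotient_atlas q \<and> x \<in> chart_image c then \<i> *s v else 0)"
  shows "integrable_acs (quotient_atlas q) J\<^sub>0"
  unfolding integrable_acs_def
proof (intro ballI)
  fix c x assume c: "c \<in> quotient_atlas q" and x: "x \<in> chart_image c"
  let ?V = "chart_image c"
  have op: "open ?V" using quotient_atlas_chart(1)[OF c] .
  have id: "smooth_on ?V (\<lambda>x. x)"
    by (rule smooth_on_bounded_linear[OF op bounded_linear_ident])
  have inv: "smooth_on ?V (inv_into ?V (\<lambda>x. x))"
    by (rule smooth_on_cong[OF op _ id]) (simp add: inv_into_f_eq)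
  have "frechet_derivative (\<lambda>x. x) (at y) v = v" for y v :: "complex^'n"
    using frechet_derivative_at[OF has_derivative_ident, of y] by metis
  then show "\<exists>V (h :: complex^'n \<Rightarrow> complex^'n). open V \<and> x \<in> V \<and> V \<subseteq> ?V \<and>
      smooth_on V h \<and> inj_on h V \<and> open (h ` V) \<and> smooth_on (h ` V) (inv_into V h) \<and>
      (\<forall>y\<in>V. \<forall>v. frechet_derivative h (at y) (J\<^sub>0 c y v) = \<i> *s frechet_derivative h (at y) v)"
    using c x op id inv by (intro exI[of _ ?V] exI[of _ "\<lambda>x. x"]) (simp add: assms inj_on_def)
qed

section \<open>The rank of the Nijenhuis tensor in a coframe\<close>

definition wedge :: "('e \<Rightarrow> complex) \<Rightarrow> ('e \<Rightarrow> complex) \<Rightarrow> 'e \<Rightarrow> 'e \<Rightarrow> complex" where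
  "wedge \<alpha> \<beta> u v = \<alpha> u * \<beta> v - \<beta> u * \<alpha> v"

text \<open>The \<open>(0,1)\<close>-part of a covector, that is, its composition with the projection \<open>u \<mapsto> (u + \<i> j u) / 2\<close>.\<close>

definition part_0_1 :: "('e \<Rightarrow> 'e) \<Rightarrow> ('e \<Rightarrow> complex) \<Rightarrow> 'e \<Rightarrow> complex" where
  "part_0_1 j \<alpha> u = (\<alpha> u + \<i> * \<alpha> (j u)) / 2"

lemma proj_0_2_wedge:
  "proj_0_2 j (wedge \<alpha> \<beta>) = wedge (part_0_1 j \<alpha>) (part_0_1 j \<beta>)"
  by (intro ext) (simp add: proj_0_2_def wedge_def part_0_1_def field_simps)

lemma wedge_0 [simp]: "wedge \<alpha> (\<lambda>u. 0) u v = 0" "wedge (\<lambda>u. 0) \<alpha> u v = 0"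
  by (simp_all add: wedge_def)

lemma part_0_1_type_1_0: "(\<And>v. \<alpha> (j v) = \<i> * \<alpha> v) \<Longrightarrow> part_0_1 j \<alpha> = (\<lambda>u. 0)"
  by (intro ext) (simp add: part_0_1_def flip: mult.assoc)

lemma part_0_1_linear:
  "part_0_1 j (\<lambda>u. \<alpha> u + \<beta> u) = (\<lambda>u. part_0_1 j \<alpha> u + part_0_1 j \<beta> u)"
  "part_0_1 j (\<lambda>u. \<alpha> u - \<beta> u) = (\<lambda>u. part_0_1 j \<alpha> u - part_0_1 j \<beta> u)"
  "part_0_1 j (\<lambda>u. a * \<alpha> u) = (\<lambda>u. a * part_0_1 j \<alpha> u)"
  by (auto simp: part_0_1_def fun_eq_iff field_simps)

lemma proj_0_2_linear:
  "proj_0_2 j (\<lambda>u v. \<beta> u v + \<gamma> u v) = (\<lambda>u v. proj_0_2 j \<beta> u v + proj_0_2 j \<gamma> u v)"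
  "proj_0_2 j (\<lambda>u v. a * \<beta> u v) = (\<lambda>u v. a * proj_0_2 j \<beta> u v)"
  "proj_0_2 j (\<lambda>u v. 0) = (\<lambda>u v. 0)"
  by (auto simp: proj_0_2_def fun_eq_iff field_simps)

lemma proj_0_2_sum:
  "proj_0_2 j (\<lambda>u v. \<Sum>i\<in>I. \<beta> i u v) = (\<lambda>u v. \<Sum>i\<in>I. proj_0_2 j (\<beta> i) u v)"
  by (induction I rule: infinite_finite_induct) (simp_all add: proj_0_2_linear)

text \<open>Independence of the family makes \<open>R\<close> injective, so the dimension counts indices.\<close>

lemma (in vector_space) dim_eq_card_family:
  assumes "finite I" "span S = span (R ` I)"
    and indep: "\<And>a. (\<Sum>i\<in>I. scale (a i) (R i)) = 0 \<Longrightarrow> \<forall>i\<in>I. a i = 0"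
  shows "dim S = card I"
proof -
  have inj: "inj_on R I"
  proof (rule inj_onI, rule ccontr)
    fix i j assume ij: "i \<in> I" "j \<in> I" "R i = R j" "i \<noteq> j"
    define a where "a = (\<lambda>k. if k = i then 1 else if k = j then - 1 else (0::'a))"
    have "(\<Sum>k\<in>I. scale (a k) (R k)) = (\<Sum>k\<in>{i, j}. scale (a k) (R k))"
      using ij assms(1) by (intro sum.mono_neutral_right) (auto simp: a_def)
    also have "\<dots> = 0"
      using ij by (simp add: a_def)
    finally show False
      using indep[of a] ij(1) by (auto simp: a_def)
  qed
  have "independent (R ` I)"
  proof (rule independent_if_scalars_zero)
    fix f v assume f: "(\<Sum>v\<in>R ` I. scale (f v) v) = 0" and v: "v \<in> R ` I"
    then have "(\<Sum>i\<in>I. scale (f (R i)) (R i)) = 0"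
      using inj by (simp add: sum.reindex)
    then show "f v = 0"
      using indep[of "\<lambda>i. f (R i)"] v by auto
  qed (use assms(1) in simp)
  then have "dim S = card (R ` I)"
    using assms(2) by (intro dim_eq_card) simp_all
  then show ?thesis
    using inj by (simp add: card_image)
qed

text \<open>Expanding \<open>e y\<close> in a basis reduces the claim to the product rule for finitely many fixed vectors.\<close>

lemma linear_family_differentiable:
  fixes F :: "'a::real_normed_vector \<Rightarrow> 'b::euclidean_space \<Rightarrow> 'c::real_normed_vector"
  assumes "open V" "x \<in> V" "\<And>y. y \<in> V \<Longrightarrow> linear (F y)"
    "\<And>v. (\<lambda>y. F y v) differentiable (at x)" "e differentiable (at x)"
  shows "(\<lambda>y. F y (e y)) differentiable (at x)"
proof -
  have "(\<lambda>y. e y \<bullet> b) differentiable (at x)" for b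
    using assms(5) by simp
  then have "(\<lambda>y. \<Sum>b\<in>Basis. (e y \<bullet> b) *\<^sub>R F y b) differentiable (at x)"
    using assms(4) by (intro differentiable_sum ballI differentiable_scaleR) auto
  then obtain D where "((\<lambda>y. \<Sum>b\<in>Basis. (e y \<bullet> b) *\<^sub>R F y b) has_derivative D) (at x)"
    unfolding differentiable_def ..
  then have "((\<lambda>y. F y (e y)) has_derivative D) (at x)"
  proof (rule has_derivative_transform_within_open[OF _ assms(1,2)])
    fix y assume "y \<in> V"
    then show "(\<Sum>b\<in>Basis. (e y \<bullet> b) *\<^sub>R F y b) = F y (e y)"
      using assms(3)
      by (subst (2) euclidean_representation[of "e y", symmetric])
        (simp add: linear_sum linear_scale)
  qed
  then show ?thesis by (auto simp: differentiable_def)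
qed

lemma complex_linear_expansion:
  fixes g :: "complex^'n \<Rightarrow> complex"
  assumes "linear g" "\<And>w. g (\<i> *s w) = \<i> * g w"
  shows "g w = (\<Sum>j\<in>UNIV. w $ j * g (axis j 1))"
proof -
  have "w = (\<Sum>j\<in>UNIV. Re (w $ j) *\<^sub>R axis j 1 + Im (w $ j) *\<^sub>R (\<i> *s axis j 1))"
    by (simp add: vec_eq_iff axis_def if_distrib complex_eq_iff cong: if_cong)
  then have "g w = g (\<Sum>j\<in>UNIV. Re (w $ j) *\<^sub>R axis j 1 + Im (w $ j) *\<^sub>R (\<i> *s axis j 1))"
    by simp
  also have "\<dots> = (\<Sum>j\<in>UNIV. Re (w $ j) *\<^sub>R g (axis j 1) + Im (w $ j) *\<^sub>R (\<i> * g (axis j 1)))"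
    by (simp only: linear_sum[OF assms(1)] linear_add[OF assms(1)] linear_scale[OF assms(1)] assms(2))
  also have "\<dots> = (\<Sum>j\<in>UNIV. w $ j * g (axis j 1))"
    by (intro sum.cong refl) (simp add: complex_eq_iff)
  finally show ?thesis .
qed

context invariant_coframe
begin

abbreviation \<psi> :: "3 \<Rightarrow> complex^3 \<Rightarrow> complex^3 \<Rightarrow> complex" where
  "\<psi> j y v \<equiv> (A y *v v) $ j"

text \<open>The \<open>(0,1)\<close>-parts of the conjugates \<open>cnj \<psi>\<^sub>k\<close>. Their wedge products form a basis of the \<open>(0,2)\<close>-covectors
  in which \<open>mubar\<close> is computed. Inverting \<open>1 - S\<close> instead of \<open>1 + S\<close> is what the projection amounts to:
  from \<open>J = \<i> (1 + 2 S + 2 S\<^sup>2)\<close> in the coordinates \<open>\<psi>\<close> one gets \<open>cnj (1 + S + S\<^sup>2)\<close>.\<close>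

definition \<theta> :: "complex \<Rightarrow> complex \<Rightarrow> complex^3 \<Rightarrow> 3 \<Rightarrow> complex^3 \<Rightarrow> complex" where
  "\<theta> \<sigma> \<tau> x k u = cnj (unshear (- \<sigma>) (- \<tau>) (A x *v u) $ k)"

lemma smooth_on_\<psi>: "open S \<Longrightarrow> smooth_on S (\<lambda>y. \<psi> j y v)"
  by (rule smooth_on_compose_linear[OF _ bounded_linear_vec_nth smooth_on_A])

lemma \<psi>_has_derivative:
  "((\<lambda>y. \<psi> j y v) has_derivative frechet_derivative (\<lambda>y. \<psi> j y v) (at x)) (at x)"
  by (rule smooth_on_has_derivative[OF smooth_on_\<psi>[OF open_UNIV]]) simp

lemma part_0_1_cnj_\<psi>:
  assumes "c \<in> M" "x \<in> chart_image c"
  shows "part_0_1 (acs \<sigma> \<tau> c x) (\<lambda>v. cnj (\<psi> k x v)) = \<theta> \<sigma> \<tau> x k"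
  using assms exhaust_3[of k]
  by (auto simp: fun_eq_iff part_0_1_def acs_def \<theta>_def sheared_i_def shear_def unshear_def field_simps)

text \<open>Since the \<open>(0,1)\<close>-part of \<open>\<omega>\<^sub>j\<close> vanishes, that of \<open>\<psi>\<^sub>j\<close> is a multiple of some \<open>\<theta>\<^sub>k\<close>. These
  substitutions compute the \<open>(0,2)\<close>-part of every 2-form written in the \<open>\<psi>\<^sub>j\<close> and their conjugates.\<close>

lemma part_0_1_\<psi>:
  assumes "c \<in> M" "x \<in> chart_image c"
  shows "part_0_1 (acs \<sigma> \<tau> c x) (\<psi> 1 x) = (\<lambda>u. - \<sigma> * \<theta> \<sigma> \<tau> x 2 u)"
    "part_0_1 (acs \<sigma> \<tau> c x) (\<psi> 2 x) = (\<lambda>u. - \<tau> * \<theta> \<sigma> \<tau> x 3 u)"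
    "part_0_1 (acs \<sigma> \<tau> c x) (\<psi> 3 x) = (\<lambda>u. 0)"
  using assms
  by (auto simp: fun_eq_iff part_0_1_def acs_def \<theta>_def sheared_i_def shear_def unshear_def field_simps)

lemma ext_deriv_add_cnj_\<psi>:
  assumes "\<And>y v. \<alpha> y v = \<psi> i y v + a * cnj (\<psi> k y v)"
  shows "ext_deriv \<alpha> x u v = ext_deriv (\<psi> i) x u v + a * cnj (ext_deriv (\<psi> k) x u v)"
proof -
  have "((\<lambda>y. \<alpha> y v) has_derivative (\<lambda>h. frechet_derivative (\<lambda>y. \<psi> i y v) (at x) h +
      a * cnj (frechet_derivative (\<lambda>y. \<psi> k y v) (at x) h))) (at x)" for v
    unfolding assms
    by (intro has_derivative_add has_derivative_mult_right has_derivative_cnj \<psi>_has_derivative)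
  from ext_deriv_eq[OF this] show ?thesis
    by (simp add: ext_deriv_def algebra_simps)
qed

lemma mubar_\<omega>:
  "mubar (acs \<sigma> \<tau>) (\<omega> \<sigma> \<tau> 1) c x =
     (\<lambda>u v. proj_0_2 (acs \<sigma> \<tau> c x) (ext_deriv (\<psi> 1) x) u v +
        \<sigma> * proj_0_2 (acs \<sigma> \<tau> c x) (\<lambda>u v. cnj (ext_deriv (\<psi> 2) x u v)) u v)"
  "mubar (acs \<sigma> \<tau>) (\<omega> \<sigma> \<tau> 2) c x =
     (\<lambda>u v. proj_0_2 (acs \<sigma> \<tau> c x) (ext_deriv (\<psi> 2) x) u v +
        \<tau> * proj_0_2 (acs \<sigma> \<tau> c x) (\<lambda>u v. cnj (ext_deriv (\<psi> 3) x u v)) u v)"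
  "mubar (acs \<sigma> \<tau>) (\<omega> \<sigma> \<tau> 3) c x = proj_0_2 (acs \<sigma> \<tau> c x) (ext_deriv (\<psi> 3) x)"
proof -
  have "ext_deriv (\<omega> \<sigma> \<tau> 1 c) x =
      (\<lambda>u v. ext_deriv (\<psi> 1) x u v + \<sigma> * cnj (ext_deriv (\<psi> 2) x u v))"
    by (intro ext ext_deriv_add_cnj_\<psi>) (simp add: \<omega>_def shear_def)
  then show "mubar (acs \<sigma> \<tau>) (\<omega> \<sigma> \<tau> 1) c x =
     (\<lambda>u v. proj_0_2 (acs \<sigma> \<tau> c x) (ext_deriv (\<psi> 1) x) u v +
        \<sigma> * proj_0_2 (acs \<sigma> \<tau> c x) (\<lambda>u v. cnj (ext_deriv (\<psi> 2) x u v)) u v)"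
    by (simp add: mubar_def proj_0_2_linear)
  have "ext_deriv (\<omega> \<sigma> \<tau> 2 c) x =
      (\<lambda>u v. ext_deriv (\<psi> 2) x u v + \<tau> * cnj (ext_deriv (\<psi> 3) x u v))"
    by (intro ext ext_deriv_add_cnj_\<psi>) (simp add: \<omega>_def shear_def)
  then show "mubar (acs \<sigma> \<tau>) (\<omega> \<sigma> \<tau> 2) c x =
     (\<lambda>u v. proj_0_2 (acs \<sigma> \<tau> c x) (ext_deriv (\<psi> 2) x) u v +
        \<tau> * proj_0_2 (acs \<sigma> \<tau> c x) (\<lambda>u v. cnj (ext_deriv (\<psi> 3) x u v)) u v)"
    by (simp add: mubar_def proj_0_2_linear)
  have "\<omega> \<sigma> \<tau> 3 c = \<psi> 3"
    by (simp add: fun_eq_iff \<omega>_def shear_def)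
  then show "mubar (acs \<sigma> \<tau>) (\<omega> \<sigma> \<tau> 3) c x = proj_0_2 (acs \<sigma> \<tau> c x) (ext_deriv (\<psi> 3) x)"
    by (simp add: mubar_def)
qed

lemma type_1_0_expansion:
  assumes "smooth_form1 M \<alpha>" "type_1_0 M (acs \<sigma> \<tau>) \<alpha>" and c: "c \<in> M" and y: "y \<in> chart_image c"
  shows "\<alpha> c y v = (\<Sum>j\<in>UNIV. \<alpha> c y (B y *v unshear \<sigma> \<tau> (axis j 1)) * \<omega> \<sigma> \<tau> j c y v)"
proof -
  define g where "g = (\<lambda>w. \<alpha> c y (B y *v unshear \<sigma> \<tau> w))"
  have "linear (\<alpha> c y)"
    using assms by (auto simp: smooth_form1_def)
  from linear_compose[OF linear_compose[OF linear_unshear linear_matrix_vector] this]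
  have g: "linear g"
    by (simp add: g_def comp_def)
  have "g (\<i> *s w) = \<i> * g w" for w
  proof -
    have "B y *v unshear \<sigma> \<tau> (\<i> *s w) = acs \<sigma> \<tau> c y (B y *v unshear \<sigma> \<tau> w)"
      using c y by (simp add: acs_def sheared_i_def)
    then show ?thesis
      using assms by (simp add: g_def type_1_0_def)
  qed
  from complex_linear_expansion[OF g this, of "shear \<sigma> \<tau> (A y *v v)"] show ?thesis
    by (simp add: g_def \<omega>_def mult.commute)
qed

text \<open>The operator is tensorial: with \<open>\<alpha> = \<Sum>\<^sub>j a\<^sub>j \<omega>\<^sub>j\<close> one has \<open>d\<alpha> = \<Sum>\<^sub>j da\<^sub>j \<and> \<omega>\<^sub>j + a\<^sub>j d\<omega>\<^sub>j\<close>, and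
  \<open>da\<^sub>j \<and> \<omega>\<^sub>j\<close> has no \<open>(0,2)\<close>-part because \<open>\<omega>\<^sub>j\<close> is of type \<open>(1,0)\<close>.\<close>

lemma mubar_in_span_\<omega>:
  assumes \<alpha>: "smooth_form1 M \<alpha>" "type_1_0 M (acs \<sigma> \<tau>) \<alpha>" and c: "c \<in> M" and x: "x \<in> chart_image c"
  shows "\<exists>a. mubar (acs \<sigma> \<tau>) \<alpha> c x =
    (\<lambda>u v. \<Sum>j\<in>UNIV. a j * mubar (acs \<sigma> \<tau>) (\<omega> \<sigma> \<tau> j) c x u v)"
proof -
  let ?V = "chart_image c" and ?J = "acs \<sigma> \<tau> c x"
  note op = quotient_atlas_chart(1)[OF c]
  define a where "a = (\<lambda>j y. \<alpha> c y (B y *v unshear \<sigma> \<tau> (axis j 1)))"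
  have d\<alpha>: "(\<lambda>y. \<alpha> c y v) differentiable (at x)" for v
    using smooth_on_has_derivative[of ?V "\<lambda>y. \<alpha> c y v" x] \<alpha>(1) c x
    by (auto simp: smooth_form1_def differentiable_def)
  have dB: "(\<lambda>y. B y *v unshear \<sigma> \<tau> w) differentiable (at x)" for w
    using smooth_on_has_derivative[OF smooth_on_B[OF op smooth_on_const[OF op]] x]
    by (auto simp: differentiable_def)
  have lin: "linear (\<alpha> c y)" if "y \<in> ?V" for y
    using \<alpha>(1) c that by (auto simp: smooth_form1_def)
  have "a j differentiable (at x)" for j
    unfolding a_def
    by (rule linear_family_differentiable[where F = "\<alpha> c", OF op x lin d\<alpha> dB])
  then obtain a' where a': "\<And>j. (a j has_derivative a' j) (at x)"
    unfolding differentiable_def by metis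
  have \<omega>': "((\<lambda>y. \<omega> \<sigma> \<tau> j c y v) has_derivative frechet_derivative (\<lambda>y. \<omega> \<sigma> \<tau> j c y v) (at x)) (at x)"
    for j v
    using smooth_form1_\<omega>[of \<sigma> \<tau> j] c
    by (intro smooth_on_has_derivative[OF _ x]) (auto simp: smooth_form1_def)
  have deriv: "((\<lambda>y. \<alpha> c y v) has_derivative (\<lambda>h. \<Sum>j\<in>UNIV.
      a j x * frechet_derivative (\<lambda>y. \<omega> \<sigma> \<tau> j c y v) (at x) h + a' j h * \<omega> \<sigma> \<tau> j c x v)) (at x)" for v
  proof (rule has_derivative_transform_within_open[OF _ op x])
    show "((\<lambda>y. \<Sum>j\<in>UNIV. a j y * \<omega> \<sigma> \<tau> j c y v) has_derivative (\<lambda>h. \<Sum>j\<in>UNIV.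
      a j x * frechet_derivative (\<lambda>y. \<omega> \<sigma> \<tau> j c y v) (at x) h + a' j h * \<omega> \<sigma> \<tau> j c x v)) (at x)"
      by (intro has_derivative_sum has_derivative_mult a' \<omega>')
  qed (simp add: a_def type_1_0_expansion[OF \<alpha> c])
  have "ext_deriv (\<alpha> c) x = (\<lambda>u v. \<Sum>j\<in>UNIV.
      a j x * ext_deriv (\<omega> \<sigma> \<tau> j c) x u v + wedge (a' j) (\<omega> \<sigma> \<tau> j c x) u v)"
    by (intro ext, subst ext_deriv_eq[OF deriv])
      (simp add: ext_deriv_def wedge_def algebra_simps flip: sum_subtractf)
  moreover have "part_0_1 ?J (\<omega> \<sigma> \<tau> j c x) = (\<lambda>u. 0)" for j
    using type_1_0_\<omega> c x by (intro part_0_1_type_1_0) (simp add: type_1_0_def)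
  ultimately have "mubar (acs \<sigma> \<tau>) \<alpha> c x =
      (\<lambda>u v. \<Sum>j\<in>UNIV. a j x * mubar (acs \<sigma> \<tau>) (\<omega> \<sigma> \<tau> j) c x u v)"
    by (simp add: mubar_def proj_0_2_sum proj_0_2_linear proj_0_2_wedge)
  then show ?thesis
    by (rule exI[of _ "\<lambda>j. a j x"])
qed

definition form_0_2 :: "complex \<Rightarrow> complex \<Rightarrow> complex^3 \<Rightarrow> complex^3 \<Rightarrow> complex^3 \<Rightarrow> complex^3 \<Rightarrow> complex" where
  "form_0_2 \<sigma> \<tau> x r u v = r $ 1 * wedge (\<theta> \<sigma> \<tau> x 1) (\<theta> \<sigma> \<tau> x 2) u v +
     r $ 2 * wedge (\<theta> \<sigma> \<tau> x 1) (\<theta> \<sigma> \<tau> x 3) u v + r $ 3 * wedge (\<theta> \<sigma> \<tau> x 2) (\<theta> \<sigma> \<tau> x 3) u v"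

text \<open>Evaluating on the frame dual to the \<open>\<theta>\<^sub>k\<close> reads off the coefficients.\<close>

lemma form_0_2_eq_0:
  assumes "\<And>u v. form_0_2 \<sigma> \<tau> x r u v = 0"
  shows "r = 0"
proof -
  define e where "e = (\<lambda>k. B x *v shear (- \<sigma>) (- \<tau>) (axis k 1))"
  have e: "\<theta> \<sigma> \<tau> x j (e k) = (if j = k then 1 else 0)" for j k
    by (simp add: \<theta>_def e_def axis_def)
  show ?thesis
    using assms[of "e 1" "e 2"] assms[of "e 1" "e 3"] assms[of "e 2" "e 3"]
    by (simp add: form_0_2_def wedge_def e vec_eq_iff forall_3)
qed

text \<open>By tensoriality the rank is that of the three vectors of coefficients of \<open>mubar \<omega>\<^sub>j\<close>. In all
  applications the nonzero ones among them are independent.\<close>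

lemma nijenhuis_rank_acs:
  assumes c: "c \<in> M" and x: "x \<in> chart_image c"
    and rows: "\<And>j. mubar (acs \<sigma> \<tau>) (\<omega> \<sigma> \<tau> j) c x = form_0_2 \<sigma> \<tau> x (r j)"
    and zero: "\<And>j. j \<notin> I \<Longrightarrow> r j = 0"
    and indep: "\<And>a. (\<Sum>j\<in>I. a j *s r j) = 0 \<Longrightarrow> \<forall>j\<in>I. a j = 0"
  shows "nijenhuis_rank M (acs \<sigma> \<tau>) c x = card I"
proof -
  interpret F: vector_space form2_scale
    by (rule vector_space_form2_scale)
  let ?S = "{mubar (acs \<sigma> \<tau>) \<alpha> c x |\<alpha>. smooth_form1 M \<alpha> \<and> type_1_0 M (acs \<sigma> \<tau>) \<alpha>}"
  let ?R = "\<lambda>j. mubar (acs \<sigma> \<tau>) (\<omega> \<sigma> \<tau> j) c x"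
  have sum_apply: "(\<Sum>j\<in>K. g j) u v = (\<Sum>j\<in>K. g j u v)"
    for K :: "3 set" and g :: "3 \<Rightarrow> complex^3 \<Rightarrow> complex^3 \<Rightarrow> complex" and u v
    by (induction K rule: infinite_finite_induct) auto
  have R0: "?R j = 0" if "j \<notin> I" for j
    using that by (simp add: rows zero form_0_2_def fun_eq_iff)
  have "?S \<subseteq> F.span (?R ` I)"
  proof clarify
    fix \<alpha> assume "smooth_form1 M \<alpha>" "type_1_0 M (acs \<sigma> \<tau>) \<alpha>"
    then obtain a where "mubar (acs \<sigma> \<tau>) \<alpha> c x = (\<lambda>u v. \<Sum>j\<in>UNIV. a j * ?R j u v)"
      using mubar_in_span_\<omega> c x by blast
    then have "mubar (acs \<sigma> \<tau>) \<alpha> c x = (\<Sum>j\<in>UNIV. form2_scale (a j) (?R j))"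
      by (simp add: fun_eq_iff sum_apply form2_scale_def)
    moreover have "?R j \<in> F.span (?R ` I)" for j
      using R0[of j] by (cases "j \<in> I") (auto intro: F.span_base F.span_zero)
    ultimately show "mubar (acs \<sigma> \<tau>) \<alpha> c x \<in> F.span (?R ` I)"
      by (simp add: F.span_sum F.span_scale)
  qed
  moreover have "?R ` I \<subseteq> ?S"
    using smooth_form1_\<omega> type_1_0_\<omega> by blast
  ultimately have "F.span ?S = F.span (?R ` I)"
    by (meson F.span_mono F.span_minimal F.subspace_span order_antisym)
  then have "F.dim ?S = card I"
  proof (rule F.dim_eq_card_family[OF finite])
    fix a assume *: "(\<Sum>j\<in>I. form2_scale (a j) (?R j)) = 0"
    have "form_0_2 \<sigma> \<tau> x (\<Sum>j\<in>I. a j *s r j) u v = (\<Sum>j\<in>I. form2_scale (a j) (?R j)) u v" for u v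
      by (simp add: rows sum_apply form2_scale_def form_0_2_def sum_distrib_right sum_distrib_left
          sum.distrib algebra_simps)
    then show "\<forall>j\<in>I. a j = 0"
      using * by (intro indep form_0_2_eq_0) simp
  qed
  then show ?thesis
    by (simp add: nijenhuis_rank_def)
qed

end

section \<open>Convergence in the \<open>C\<^sup>0\<close> topology\<close>

lemma continuous_on_vecI:
  fixes f :: "'a::topological_space \<Rightarrow> 'b::topological_space^'n"
  assumes "\<And>i. continuous_on S (\<lambda>x. f x $ i)"
  shows "continuous_on S f"
  using continuous_on_vec_lambda[of S "\<lambda>i x. f x $ i"] assms by simp

lemma onorm_le_sum_Basis:
  fixes f :: "'a::euclidean_space \<Rightarrow> 'b::real_normed_vector"
  assumes "linear f"
  shows "onorm f \<le> (\<Sum>b\<in>Basis. norm (f b))"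
proof (rule onorm_bound)
  fix v
  have "norm (f v) = norm (\<Sum>b\<in>Basis. (v \<bullet> b) *\<^sub>R f b)"
    by (subst euclidean_representation[of v, symmetric])
      (simp add: linear_sum[OF assms] linear_scale[OF assms])
  also have "\<dots> \<le> (\<Sum>b\<in>Basis. norm (f b) * norm v)"
    by (intro sum_norm_le) (simp add: mult.commute[of _ "norm v"] Basis_le_norm mult_right_mono)
  finally show "norm (f v) \<le> (\<Sum>b\<in>Basis. norm (f b)) * norm v"
    by (simp add: sum_distrib_right)
qed (simp add: sum_nonneg)

lemma continuous_on_onorm:
  fixes F :: "'x::topological_space \<Rightarrow> 'a::euclidean_space \<Rightarrow> 'b::real_normed_vector"
  assumes lin: "\<And>y. y \<in> S \<Longrightarrow> linear (F y)" and cont: "\<And>v. continuous_on S (\<lambda>y. F y v)"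
  shows "continuous_on S (\<lambda>y. onorm (F y))"
  unfolding continuous_on_def
proof
  fix x assume x: "x \<in> S"
  have le: "onorm (F y) \<le> onorm (F z) + (\<Sum>b\<in>Basis. norm (F y b - F z b))"
    if "y \<in> S" "z \<in> S" for y z
  proof -
    have l: "linear (\<lambda>v. F y v - F z v)"
      using that lin by (simp add: linear_compose_sub)
    then have "onorm (\<lambda>v. F z v + (F y v - F z v)) \<le> onorm (F z) + onorm (\<lambda>v. F y v - F z v)"
      using that lin by (intro onorm_triangle) (simp_all add: linear_conv_bounded_linear)
    then show ?thesis
      using onorm_le_sum_Basis[OF l] by simp
  qed
  have "\<bar>onorm (F y) - onorm (F x)\<bar> \<le> (\<Sum>b\<in>Basis. norm (F y b - F x b))" if "y \<in> S" for y
    using le[OF that x] le[OF x that] by (simp add: norm_minus_commute)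
  then have ev: "\<forall>\<^sub>F y in at x within S. norm (onorm (F y) - onorm (F x)) \<le> (\<Sum>b\<in>Basis. norm (F y b - F x b))"
    by (simp add: eventually_at_filter)
  have "((\<lambda>y. \<Sum>b\<in>Basis. norm (F y b - F x b)) \<longlongrightarrow> (\<Sum>b\<in>Basis. norm (F x b - F x b))) (at x within S)"
    using cont x unfolding continuous_on_def by (intro tendsto_intros) blast
  then have lim: "((\<lambda>y. \<Sum>b\<in>Basis. norm (F y b - F x b)) \<longlongrightarrow> 0) (at x within S)"
    by simp
  have "((\<lambda>y. onorm (F y) - onorm (F x)) \<longlongrightarrow> 0) (at x within S)"
    by (rule Lim_null_comparison[OF ev lim])
  then show "((\<lambda>y. onorm (F y)) \<longlongrightarrow> onorm (F x)) (at x within S)"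
    by (rule LIM_zero_cancel)
qed

lemma continuous_on_sheared_i:
  assumes "continuous_on S \<sigma>" "continuous_on S \<tau>" "continuous_on S w"
  shows "continuous_on S (\<lambda>y. sheared_i (\<sigma> y) (\<tau> y) (w y))"
proof (rule continuous_on_vecI)
  fix i :: 3
  show "continuous_on S (\<lambda>y. sheared_i (\<sigma> y) (\<tau> y) (w y) $ i)"
    using exhaust_3[of i]
    by (elim disjE; simp add: sheared_i_def shear_def unshear_def; intro continuous_intros assms)
qed

lemma continuous_on_matrix_vector:
  fixes A :: "'a::topological_space \<Rightarrow> complex^'n^'m"
  assumes "\<And>i j. continuous_on S (\<lambda>y. A y $ i $ j)" "continuous_on S w"
  shows "continuous_on S (\<lambda>y. A y *v w y)"
  by (rule continuous_on_vecI, simp add: matrix_vector_mult_def)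
    (intro continuous_on_sum continuous_on_mult assms continuous_on_component)

context invariant_coframe
begin

text \<open>The operator norm is jointly continuous in \<open>s\<close> and \<open>x\<close>. Over the compact set \<open>K\<close> its values for \<open>s = 0\<close>
  stay below some number smaller than \<open>\<delta>\<close>, and the values for small \<open>s\<close> are uniformly close to them.\<close>

lemma eventually_acs_onorm_less:
  assumes J1: "almost_complex_structure M J\<^sub>1" and c: "c \<in> M"
    and K: "compact K" "K \<subseteq> chart_image c"
    and less: "\<forall>x\<in>K. onorm (\<lambda>v. acs 0 0 c x v - J\<^sub>1 c x v) < \<delta>"
  shows "\<forall>\<^sub>F s in at 0. \<forall>x\<in>K. onorm (\<lambda>v. acs (s * a) (s * b) c x v - J\<^sub>1 c x v) < \<delta>"
proof (cases "K = {}")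
  case False
  define G where "G = (\<lambda>(s, x). onorm (\<lambda>v. acs (s * a) (s * b) c x v - J\<^sub>1 c x v))"
  have ent: "continuous_on UNIV (\<lambda>z. A z $ i $ j)" "continuous_on UNIV (\<lambda>z. B z $ i $ j)" for i j
    by (intro smooth_on_continuous smooth_A smooth_B)+
  have "continuous_on (UNIV \<times> K) (\<lambda>p. onorm (\<lambda>v. acs (fst p * a) (fst p * b) c (snd p) v - J\<^sub>1 c (snd p) v))"
  proof (rule continuous_on_onorm)
    fix p assume "p \<in> (UNIV :: complex set) \<times> K"
    then show "linear (\<lambda>v. acs (fst p * a) (fst p * b) c (snd p) v - J\<^sub>1 c (snd p) v)"
      using J1 almost_complex_structure_acs[of "fst p * a" "fst p * b"] c K(2)
      by (intro linear_compose_sub) (auto simp: almost_complex_structure_def)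
  next
    fix v
    have "continuous_on (UNIV \<times> K) (\<lambda>p :: complex \<times> _. B (snd p) *v
        sheared_i (fst p * a) (fst p * b) (A (snd p) *v v))"
      by (intro continuous_on_matrix_vector continuous_on_sheared_i continuous_intros
          continuous_on_compose2[OF ent(1) continuous_on_snd]
          continuous_on_compose2[OF ent(2) continuous_on_snd]) auto
    then have "continuous_on (UNIV \<times> K) (\<lambda>p. acs (fst p * a) (fst p * b) c (snd p) v)"
      by (rule continuous_on_eq) (use c K(2) in \<open>auto simp: acs_def\<close>)
    moreover have "smooth_on (chart_image c) (\<lambda>x. J\<^sub>1 c x v)"
      using J1 c unfolding almost_complex_structure_def by blast
    then have "continuous_on K (\<lambda>x. J\<^sub>1 c x v)"
      by (rule continuous_on_subset[OF smooth_on_continuous K(2)])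
    then have "continuous_on (UNIV \<times> K) (\<lambda>p :: complex \<times> _. J\<^sub>1 c (snd p) v)"
      by (rule continuous_on_compose2) (auto intro: continuous_intros)
    ultimately show "continuous_on (UNIV \<times> K)
        (\<lambda>p. acs (fst p * a) (fst p * b) c (snd p) v - J\<^sub>1 c (snd p) v)"
      by (rule continuous_on_diff)
  qed
  then have G: "continuous_on (UNIV \<times> K) G"
    by (simp add: G_def case_prod_unfold)
  have "continuous_on K (\<lambda>x. G (0, x))"
    by (rule continuous_on_compose2[OF G]) (auto intro: continuous_intros)
  then obtain x\<^sub>0 where x\<^sub>0: "x\<^sub>0 \<in> K" "\<And>x. x \<in> K \<Longrightarrow> G (0, x) \<le> G (0, x\<^sub>0)"
    using continuous_attains_sup[OF K(1) False] by blast
  then have "G (0, x\<^sub>0) < \<delta>"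
    using less by (simp add: G_def)
  then have "(\<delta> - G (0, x\<^sub>0)) / 2 > 0"
    by simp
  \<comment> \<open>half of the gap below \<open>\<delta>\<close> is left for the variation in \<open>s\<close>\<close>
  from continuous_on_prod_compactE[OF G K(1) UNIV_I this, of 0] obtain X where X: "0 \<in> X" "open X"
      "\<forall>s\<in>X \<inter> UNIV. \<forall>x\<in>K. dist (G (s, x)) (G (0, x)) \<le> (\<delta> - G (0, x\<^sub>0)) / 2"
    by metis
  have "G (s, x) < \<delta>" if "s \<in> X" "x \<in> K" for s x
  proof -
    have "dist (G (s, x)) (G (0, x)) \<le> (\<delta> - G (0, x\<^sub>0)) / 2"
      using X(3) that by blast
    then have "G (s, x) \<le> G (0, x) + (\<delta> - G (0, x\<^sub>0)) / 2"
      unfolding dist_real_def by linarith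
    also have "\<dots> < \<delta>"
      using x\<^sub>0(2)[OF that(2)] \<open>G (0, x\<^sub>0) < \<delta>\<close> by (simp add: field_simps)
    finally show ?thesis .
  qed
  then show ?thesis
    using X by (auto simp: eventually_at_topological G_def)
qed simp

lemma eventually_acs_in_open:
  assumes "openin (C0_topology M) U" "acs 0 0 \<in> U"
  shows "\<forall>\<^sub>F s in at 0. acs (s * a) (s * b) \<in> U"
proof -
  have "generate_topology_on
     {{J. almost_complex_structure M J \<and> (\<forall>x\<in>K. onorm (\<lambda>v. J c x v - J\<^sub>1 c x v) < \<delta>)}
      | J\<^sub>1 c K \<delta>. almost_complex_structure M J\<^sub>1 \<and> c \<in> M \<and>
          compact K \<and> K \<subseteq> chart_image c \<and> (0::real) < \<delta>} U"
    using assms(1) by (simp add: C0_topology_def openin_topology_generated_by_iff)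
  then show ?thesis
    using assms(2)
  proof (induction rule: generate_topology_on.induct)
    case (Int U V)
    then show ?case by (auto intro: eventually_conj)
  next
    case (UN \<U>)
    then obtain U where "U \<in> \<U>" "acs 0 0 \<in> U" by blast
    then have "\<forall>\<^sub>F s in at 0. acs (s * a) (s * b) \<in> U"
      using UN by blast
    then show ?case
      using \<open>U \<in> \<U>\<close> by (auto elim: eventually_mono)
  next
    case (Basis S)
    then obtain J\<^sub>1 c K \<delta> where S:
        "S = {J. almost_complex_structure M J \<and> (\<forall>x\<in>K. onorm (\<lambda>v. J c x v - J\<^sub>1 c x v) < \<delta>)}"
        "almost_complex_structure M J\<^sub>1" "c \<in> M" "compact K" "K \<subseteq> chart_image c"
      by blast
    then have "\<forall>\<^sub>F s in at 0. \<forall>x\<in>K. onorm (\<lambda>v. acs (s * a) (s * b) c x v - J\<^sub>1 c x v) < \<delta>"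
      using Basis.prems by (intro eventually_acs_onorm_less) auto
    then show ?case
      by (rule eventually_mono) (simp add: S almost_complex_structure_acs)
  qed simp
qed

end

text \<open>The structure at \<open>s = 0\<close> is multiplication by \<open>\<i>\<close> for every coframe \<open>A\<close>. Hence the coframe may be chosen
  separately for each rank, and the curves still start at the same \<open>J\<^sub>0\<close>.\<close>

lemma constant_rank_deformations:
  fixes q :: "complex^3 \<Rightarrow> 'p"
  assumes "\<And>k :: nat. k \<in> {0, 1, 2, 3} \<Longrightarrow> \<exists>A B a b. invariant_coframe q A B \<and>
    (\<forall>s. s \<noteq> 0 \<longrightarrow> constant_rank (quotient_atlas q) (invariant_coframe.acs q A B (s * a) (s * b)) k)"
  defines "M \<equiv> quotient_atlas q"
  shows "\<exists>J\<^sub>0. almost_complex_structure M J\<^sub>0 \<and> integrable_acs M J\<^sub>0 \<and>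
     (\<forall>k\<in>{0, 1, 2, 3::nat}. \<exists>\<epsilon>>0. \<exists>J. acs_curve M J\<^sub>0 \<epsilon> J \<and>
        (\<forall>s. s \<noteq> 0 \<and> norm s < \<epsilon> \<longrightarrow> constant_rank M (J s) k)) \<and>
     (\<forall>U. openin (C0_topology M) U \<and> J\<^sub>0 \<in> U \<longrightarrow>
        (\<forall>k\<in>{0, 1, 2, 3::nat}. \<exists>J\<in>U. almost_complex_structure M J \<and> constant_rank M J k))"
proof -
  define J\<^sub>0 :: "('p, complex^3) endo_field"
    where "J\<^sub>0 = (\<lambda>c x v. if c \<in> M \<and> x \<in> chart_image c then \<i> *s v else 0)"
  have int: "integrable_acs M J\<^sub>0"
    using integrable_acs_standard[of J\<^sub>0 q] by (simp add: J\<^sub>0_def M_def)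
  have main: "almost_complex_structure M J\<^sub>0 \<and>
      (\<exists>\<epsilon>>0. \<exists>J. acs_curve M J\<^sub>0 \<epsilon> J \<and> (\<forall>s. s \<noteq> 0 \<and> norm s < \<epsilon> \<longrightarrow> constant_rank M (J s) k)) \<and>
      (\<forall>U. openin (C0_topology M) U \<and> J\<^sub>0 \<in> U \<longrightarrow>
        (\<exists>J\<in>U. almost_complex_structure M J \<and> constant_rank M J k))"
    if k: "k \<in> {0, 1, 2, 3}" for k :: nat
  proof -
    obtain A B a b where "invariant_coframe q A B" and
      rank: "\<And>s. s \<noteq> 0 \<Longrightarrow> constant_rank M (invariant_coframe.acs q A B (s * a) (s * b)) k"
      using assms(1)[OF k] unfolding M_def by blast
    then interpret invariant_coframe q A B by simp
    have J0: "J\<^sub>0 = acs 0 0"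
      by (simp add: J\<^sub>0_def acs_0 M_def)
    have "acs_curve M J\<^sub>0 1 (\<lambda>s. acs (s * a) (s * b))"
      unfolding J0 M_def by (rule acs_curve_acs)
    moreover have "\<exists>J\<in>U. almost_complex_structure M J \<and> constant_rank M J k"
      if U: "openin (C0_topology M) U" "J\<^sub>0 \<in> U" for U
    proof -
      have "\<forall>\<^sub>F s in at 0. acs (s * a) (s * b) \<in> U"
        using U by (intro eventually_acs_in_open) (simp_all add: J0 M_def)
      moreover have "\<forall>\<^sub>F s in at 0. s \<noteq> (0 :: complex)"
        by (simp add: eventually_at_filter)
      ultimately have "\<forall>\<^sub>F s in at (0 :: complex). acs (s * a) (s * b) \<in> U \<and> s \<noteq> 0"
        by (rule eventually_conj)
      then obtain s where "acs (s * a) (s * b) \<in> U" "s \<noteq> 0"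
        using eventually_happens[of _ "at (0 :: complex)"] trivial_limit_at by blast
      then show ?thesis
        using rank almost_complex_structure_acs by (auto simp: M_def)
    qed
    ultimately show ?thesis
      using rank almost_complex_structure_acs[of 0 0]
      by (intro conjI exI[of _ "1::real"] exI[of _ "\<lambda>s. acs (s * a) (s * b)"]) (auto simp: J0 M_def)
  qed
  then show ?thesis
    using int by (intro exI[of _ J\<^sub>0]) blast
qed

section \<open>Coset spaces and periodic functions\<close>

text \<open>Points of the same coset differ by an element of \<open>H\<close>, and translation by that element preserves all
  cosets. So the translations by \<open>H\<close> relate the points of each fibre of the quotient map.\<close>

lemma lcoset_deck:
  fixes G (structure)
  assumes "group G" "subgroup H G" "carrier G = UNIV" "z <#\<^bsub>G\<^esub> H = w <#\<^bsub>G\<^esub> H"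
  shows "\<exists>h\<in>H. z \<otimes>\<^bsub>G\<^esub> h = w \<and> (\<forall>y. (y \<otimes>\<^bsub>G\<^esub> h) <#\<^bsub>G\<^esub> H = y <#\<^bsub>G\<^esub> H)"
proof -
  interpret group G by fact
  have "w \<otimes> \<one> \<in> z <# H"
    using subgroup.one_closed[OF assms(2)] unfolding assms(4) by (auto simp: l_coset_def)
  then obtain h where h: "h \<in> H" "z \<otimes> h = w"
    using assms(3) by (auto simp: l_coset_def)
  have "(y \<otimes> h) <# H = y <# H" for y
    using lcos_m_assoc[of H y h] coset_join3[OF _ assms(2) h(1)] assms(3) by simp
  with h show ?thesis by blast
qed

lemma rcoset_deck:
  fixes G (structure)
  assumes "group G" "subgroup H G" "carrier G = UNIV" "H #>\<^bsub>G\<^esub> z = H #>\<^bsub>G\<^esub> w"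
  shows "\<exists>h\<in>H. h \<otimes>\<^bsub>G\<^esub> z = w \<and> (\<forall>y. H #>\<^bsub>G\<^esub> (h \<otimes>\<^bsub>G\<^esub> y) = H #>\<^bsub>G\<^esub> y)"
proof -
  interpret group G by fact
  have "\<one> \<otimes> w \<in> H #> z"
    using subgroup.one_closed[OF assms(2)] unfolding assms(4) by (auto simp: r_coset_def)
  then obtain h where h: "h \<in> H" "h \<otimes> z = w"
    using assms(3) by (auto simp: r_coset_def)
  have "H #> (h \<otimes> y) = H #> y" for y
    using coset_mult_assoc[of H h y] coset_join2[OF _ assms(2) h(1)] assms(3) by simp
  with h show ?thesis by blast
qed

lemma gauss_ints_closed:
  "0 \<in> gauss_ints" "1 \<in> gauss_ints"
  "z \<in> gauss_ints \<Longrightarrow> - z \<in> gauss_ints"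
  "z \<in> gauss_ints \<Longrightarrow> w \<in> gauss_ints \<Longrightarrow> z + w \<in> gauss_ints"
  "z \<in> gauss_ints \<Longrightarrow> w \<in> gauss_ints \<Longrightarrow> z * w \<in> gauss_ints"
  by (simp_all add: gauss_ints_def)

text \<open>This is \<open>exp (2 \<pi> \<i> Re z)\<close>, a nowhere vanishing periodic function. Written with the conjugate, it shows that both
  the \<open>z\<close>- and the conjugate derivative are \<open>\<pi> \<i>\<close> times the function and never vanish.\<close>

definition wave :: "complex \<Rightarrow> complex" where
  "wave z = exp (pi * \<i> * (z + cnj z))"

lemma wave_nonzero [simp]: "wave z \<noteq> 0"
  by (simp add: wave_def)

lemma wave_periodic:
  assumes "\<gamma> \<in> gauss_ints"
  shows "wave (z + \<gamma>) = wave z"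
proof -
  obtain n where n: "Re \<gamma> = of_int n"
    using assms by (auto simp: gauss_ints_def elim: Ints_cases)
  have cnj: "cnj \<gamma> = 2 * of_int n - \<gamma>"
    by (simp add: complex_eq_iff n)
  have "pi * \<i> * (z + \<gamma> + cnj (z + \<gamma>)) = pi * \<i> * (z + cnj z) + of_int (2 * n) * pi * \<i>"
    by (simp add: cnj algebra_simps)
  then show ?thesis
    unfolding wave_def exp_eq by blast
qed

lemma has_derivative_exp_compose:
  fixes f :: "'a::real_normed_vector \<Rightarrow> complex"
  assumes "(f has_derivative f') (at x)"
  shows "((\<lambda>y. exp (f y)) has_derivative (\<lambda>h. exp (f x) * f' h)) (at x)"
  by (rule has_derivative_compose[OF assms has_field_derivative_imp_has_derivative[OF DERIV_exp]])

lemma has_derivative_wave: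
  fixes f :: "'a::real_normed_vector \<Rightarrow> complex"
  assumes "(f has_derivative f') (at x)"
  shows "((\<lambda>y. wave (f y)) has_derivative (\<lambda>h. pi * \<i> * wave (f x) * (f' h + cnj (f' h)))) (at x)"
proof -
  have "((\<lambda>y. pi * \<i> * (f y + cnj (f y))) has_derivative (\<lambda>h. pi * \<i> * (f' h + cnj (f' h)))) (at x)"
    by (intro has_derivative_mult_right has_derivative_add has_derivative_cnj assms)
  from has_derivative_exp_compose[OF this] show ?thesis
    by (simp add: wave_def mult_ac)
qed

lemma smooth_on_wave: "open S \<Longrightarrow> smooth_on S f \<Longrightarrow> smooth_on S (\<lambda>y. wave (f y))"
  unfolding wave_def by (intro smooth_on_intros)

lemma has_derivative_nth: "((\<lambda>y. y $ i) has_derivative (\<lambda>h. h $ i)) (at x)"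
  by (rule bounded_linear_imp_has_derivative[OF bounded_linear_vec_nth])

section \<open>The torus\<close>

text \<open>Forms with constant coefficients are closed, so the coframe itself has to vary:
  \<open>\<psi>\<^sub>1 = dz\<^sub>1\<close>, \<open>\<psi>\<^sub>2 = dz\<^sub>2 + p dz\<^sub>1\<close>, \<open>\<psi>\<^sub>3 = dz\<^sub>3 + r dz\<^sub>1\<close> with \<open>p = a wave z\<^sub>3\<close> and \<open>r = b wave z\<^sub>1\<close>. The
  deformation replaces \<open>\<psi>\<^sub>1\<close> by \<open>\<psi>\<^sub>1 + s cnj \<psi>\<^sub>2\<close>, which turns the \<open>(1,1)\<close>-parts of \<open>d\<psi>\<^sub>2\<close> and \<open>d\<psi>\<^sub>3\<close> into
  \<open>(0,2)\<close>-parts and adds to \<open>d\<omega>\<^sub>1\<close> the conjugate of \<open>d\<psi>\<^sub>2\<close>.\<close>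

definition torus_coframe :: "complex \<Rightarrow> complex \<Rightarrow> complex^3 \<Rightarrow> complex^3^3" where
  "torus_coframe a b z = vector [vector [1, 0, 0], vector [a * wave (z $ 3), 1, 0], vector [b * wave (z $ 1), 0, 1]]"

definition torus_frame :: "complex \<Rightarrow> complex \<Rightarrow> complex^3 \<Rightarrow> complex^3^3" where
  "torus_frame a b z = vector [vector [1, 0, 0], vector [- a * wave (z $ 3), 1, 0], vector [- b * wave (z $ 1), 0, 1]]"

lemma torus_coframe_vec:
  "torus_coframe a b z *v v = vector [v $ 1, v $ 2 + a * wave (z $ 3) * v $ 1, v $ 3 + b * wave (z $ 1) * v $ 1]"
  by (simp add: torus_coframe_def vec_eq_iff forall_3 matrix_vector_mult_def sum_3)

lemma group_translation_group: "group translation_group"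
proof (rule groupI)
  fix z assume "z \<in> carrier translation_group"
  have "- z \<otimes>\<^bsub>translation_group\<^esub> z = \<one>\<^bsub>translation_group\<^esub>"
    by (simp add: translation_group_def)
  then show "\<exists>y\<in>carrier translation_group. y \<otimes>\<^bsub>translation_group\<^esub> z = \<one>\<^bsub>translation_group\<^esub>"
    by (rule bexI) (simp add: translation_group_def)
qed (simp_all add: translation_group_def)

lemma subgroup_gauss_translations: "subgroup {z. \<forall>i. z $ i \<in> gauss_ints} translation_group"
proof (rule group.subgroupI[OF group_translation_group])
  fix z :: "complex^3" assume "z \<in> {z. \<forall>i. z $ i \<in> gauss_ints}"
  moreover have "inv\<^bsub>translation_group\<^esub> z = - z"
    by (rule group.inv_equality[OF group_translation_group]) (simp_all add: translation_group_def)
  ultimately show "inv\<^bsub>translation_group\<^esub> z \<in> {z. \<forall>i. z $ i \<in> gauss_ints}"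
    by (simp add: gauss_ints_closed)
qed (auto simp: translation_group_def gauss_ints_closed intro: exI[of _ 0])

lemma invariant_coframe_torus:
  "invariant_coframe (\<lambda>z. z <#\<^bsub>translation_group\<^esub> {z. \<forall>i. z $ i \<in> gauss_ints})
     (torus_coframe a b) (torus_frame a b)"
proof
  fix z w
  assume "z <#\<^bsub>translation_group\<^esub> {z. \<forall>i. z $ i \<in> gauss_ints}
      = w <#\<^bsub>translation_group\<^esub> {z. \<forall>i. z $ i \<in> gauss_ints}"
  from lcoset_deck[OF group_translation_group subgroup_gauss_translations _ this] obtain \<gamma> where
    \<gamma>: "\<And>i. \<gamma> $ i \<in> gauss_ints" "z + \<gamma> = w" "\<And>y. (y + \<gamma>) <#\<^bsub>translation_group\<^esub> {z. \<forall>i. z $ i \<in> gauss_ints}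
      = y <#\<^bsub>translation_group\<^esub> {z. \<forall>i. z $ i \<in> gauss_ints}"
    by (auto simp: translation_group_def)
  have "((\<lambda>y. y + \<gamma>) has_derivative (\<lambda>v. v)) (at y)" for y
    by (auto intro!: derivative_eq_intros)
  moreover have "torus_coframe a b (y + \<gamma>) *v v = torus_coframe a b y *v v" for y v
    using \<gamma>(1) by (simp add: torus_coframe_vec wave_periodic)
  ultimately show "\<exists>T T'. T z = w \<and> (\<forall>y. T y <#\<^bsub>translation_group\<^esub> {z. \<forall>i. z $ i \<in> gauss_ints}
      = y <#\<^bsub>translation_group\<^esub> {z. \<forall>i. z $ i \<in> gauss_ints}) \<and>
      (\<forall>y. (T has_derivative T' y) (at y)) \<and> (\<forall>y v. torus_coframe a b (T y) *v T' y v = torus_coframe a b y *v v)"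
    using \<gamma>(2,3) by (intro exI[of _ "\<lambda>y. y + \<gamma>"] exI[of _ "\<lambda>_ v. v"]) simp
next
  fix z show "torus_coframe a b z ** torus_frame a b z = mat 1" "torus_frame a b z ** torus_coframe a b z = mat 1"
    by (simp_all add: torus_coframe_def torus_frame_def matrix_matrix_mult_def mat_def vec_eq_iff forall_3 sum_3)
next
  fix i j :: 3
  show "smooth_on UNIV (\<lambda>z. torus_coframe a b z $ i $ j)" "smooth_on UNIV (\<lambda>z. torus_frame a b z $ i $ j)"
    using exhaust_3[of i] exhaust_3[of j]
    by (auto simp: torus_coframe_def torus_frame_def smooth_on_intros smooth_on_wave)
qed

context
  fixes a b :: complex
begin

interpretation invariant_coframe "\<lambda>z. z <#\<^bsub>translation_group\<^esub> {z. \<forall>i. z $ i \<in> gauss_ints}"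
  "torus_coframe a b" "torus_frame a b"
  by (rule invariant_coframe_torus)

lemma torus_ext_deriv:
  "ext_deriv (\<psi> 1) x = (\<lambda>u v. 0)"
  "ext_deriv (\<psi> 2) x = (\<lambda>u v. (pi * \<i> * (a * wave (x $ 3))) *
     wedge (\<lambda>u. (\<psi> 3 x u - b * wave (x $ 1) * \<psi> 1 x u) +
       (cnj (\<psi> 3 x u) - cnj (b * wave (x $ 1)) * cnj (\<psi> 1 x u))) (\<psi> 1 x) u v)"
  "ext_deriv (\<psi> 3) x = (\<lambda>u v. (pi * \<i> * (b * wave (x $ 1))) *
     wedge (\<lambda>u. \<psi> 1 x u + cnj (\<psi> 1 x u)) (\<psi> 1 x) u v)"
proof -
  have d1: "((\<lambda>y. \<psi> 1 y v) has_derivative (\<lambda>h. 0)) (at x)" for v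
    by (simp add: torus_coframe_vec)
  have d2: "((\<lambda>y. \<psi> 2 y v) has_derivative
      (\<lambda>h. a * (pi * \<i> * wave (x $ 3) * (h $ 3 + cnj (h $ 3))) * v $ 1)) (at x)" for v
    by (auto simp: torus_coframe_vec intro!: derivative_eq_intros has_derivative_nth has_derivative_wave
        has_derivative_exp_compose)
  have d3: "((\<lambda>y. \<psi> 3 y v) has_derivative
      (\<lambda>h. b * (pi * \<i> * wave (x $ 1) * (h $ 1 + cnj (h $ 1))) * v $ 1)) (at x)" for v
    by (auto simp: torus_coframe_vec intro!: derivative_eq_intros has_derivative_nth has_derivative_wave
        has_derivative_exp_compose)
  show "ext_deriv (\<psi> 1) x = (\<lambda>u v. 0)"
    by (intro ext, subst ext_deriv_eq[OF d1]) simp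
  show "ext_deriv (\<psi> 2) x = (\<lambda>u v. (pi * \<i> * (a * wave (x $ 3))) *
     wedge (\<lambda>u. (\<psi> 3 x u - b * wave (x $ 1) * \<psi> 1 x u) +
       (cnj (\<psi> 3 x u) - cnj (b * wave (x $ 1)) * cnj (\<psi> 1 x u))) (\<psi> 1 x) u v)"
    by (intro ext, subst ext_deriv_eq[OF d2]) (simp add: torus_coframe_vec wedge_def algebra_simps)
  show "ext_deriv (\<psi> 3) x = (\<lambda>u v. (pi * \<i> * (b * wave (x $ 1))) *
     wedge (\<lambda>u. \<psi> 1 x u + cnj (\<psi> 1 x u)) (\<psi> 1 x) u v)"
    by (intro ext, subst ext_deriv_eq[OF d3]) (simp add: torus_coframe_vec wedge_def algebra_simps)
qed

lemma torus_rows: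
  fixes s :: complex
  assumes c: "c \<in> M" and x: "x \<in> chart_image c"
  shows "mubar (acs s 0) (\<omega> s 0 j) c x = form_0_2 s 0 x
    (if j = 1 then vector [s * s * pi * \<i> * cnj (a * wave (x $ 3)) * (b * wave (x $ 1)),
        s * pi * \<i> * cnj (a * wave (x $ 3)), 0]
     else if j = 2 then vector [s * pi * \<i> * (a * wave (x $ 3)) * cnj (b * wave (x $ 1)), 0,
        s * pi * \<i> * (a * wave (x $ 3))]
     else vector [- s * pi * \<i> * (b * wave (x $ 1)), 0, 0])"
proof -
  define p where "p = a * wave (x $ 3)"
  define r where "r = b * wave (x $ 1)"
  have cnj2: "(\<lambda>u v. cnj (ext_deriv (\<psi> 2) x u v)) = (\<lambda>u v. - (pi * \<i> * cnj p) *
      wedge (\<lambda>u. (\<psi> 3 x u - r * \<psi> 1 x u) + (cnj (\<psi> 3 x u) - cnj r * cnj (\<psi> 1 x u)))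
        (\<lambda>u. cnj (\<psi> 1 x u)) u v)"
    by (simp add: torus_ext_deriv wedge_def p_def r_def fun_eq_iff algebra_simps)
  note ext = torus_ext_deriv[of x, folded p_def r_def]
  note proj = proj_0_2_linear proj_0_2_wedge part_0_1_linear part_0_1_\<psi>[OF c x]
    part_0_1_cnj_\<psi>[OF c x]
  note [simp] = form_0_2_def wedge_def fun_eq_iff
  show ?thesis
    unfolding p_def[symmetric] r_def[symmetric]
    using exhaust_3[of j]
    by (elim disjE; simp only: mubar_\<omega> cnj2; simp only: ext proj; simp add: algebra_simps)
qed

text \<open>The factor \<open>b\<close> makes \<open>mubar \<omega>\<^sub>3\<close> nonzero, with values in the span of \<open>\<theta>\<^sub>1 \<and> \<theta>\<^sub>2\<close>; the factor \<open>a\<close> does so for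
  \<open>\<omega>\<^sub>1\<close> and \<open>\<omega>\<^sub>2\<close>, whose values have independent components along \<open>\<theta>\<^sub>1 \<and> \<theta>\<^sub>3\<close> and \<open>\<theta>\<^sub>2 \<and> \<theta>\<^sub>3\<close>.\<close>

lemma torus_constant_rank:
  fixes s :: complex and I :: "3 set"
  assumes "s \<noteq> 0" and I: "I = (if b = 0 then {} else {3}) \<union> (if a = 0 then {} else {1, 2})"
  shows "constant_rank M (acs s 0) (card I)"
  unfolding constant_rank_def
proof (intro ballI)
  fix c x assume c: "c \<in> M" and x: "x \<in> chart_image c"
  let ?r = "\<lambda>j :: 3. (if j = 1 then vector [s * s * pi * \<i> * cnj (a * wave (x $ 3)) * (b * wave (x $ 1)),
        s * pi * \<i> * cnj (a * wave (x $ 3)), 0]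
     else if j = 2 then vector [s * pi * \<i> * (a * wave (x $ 3)) * cnj (b * wave (x $ 1)), 0,
        s * pi * \<i> * (a * wave (x $ 3))]
     else vector [- s * pi * \<i> * (b * wave (x $ 1)), 0, 0]) :: complex^3"
  show "nijenhuis_rank M (acs s 0) c x = card I"
  proof (rule nijenhuis_rank_acs[OF c x torus_rows[OF c x]])
    show "?r j = 0" if "j \<notin> I" for j :: 3
      using that exhaust_3[of j] by (auto simp: I vec_eq_iff forall_3 split: if_splits)
    fix f assume "(\<Sum>j\<in>I. f j *s ?r j) = 0"
    then show "\<forall>j\<in>I. f j = 0"
      using assms(1) by (auto simp: I vec_eq_iff forall_3 split: if_splits)
  qed
qed

end

section \<open>The Iwasawa manifold\<close>

text \<open>The invariant forms are \<open>\<phi>\<^sub>1 = dz\<^sub>1\<close>, \<open>\<phi>\<^sub>2 = dz\<^sub>2\<close> and \<open>\<phi>\<^sub>3 = dz\<^sub>3 - z\<^sub>2 dz\<^sub>1\<close>, with \<open>d\<phi>\<^sub>3 = \<phi>\<^sub>1 \<and> \<phi>\<^sub>2\<close>. The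
  coframe is \<open>\<phi>\<^sub>1\<close>, \<open>\<phi>\<^sub>2 + h \<phi>\<^sub>3\<close>, \<open>\<phi>\<^sub>3\<close> with \<open>h = e wave z\<^sub>1\<close>; for \<open>e = 0\<close> it has constant structure
  equations, which suffice up to rank 2.\<close>

definition iwasawa_coframe :: "complex \<Rightarrow> complex^3 \<Rightarrow> complex^3^3" where
  "iwasawa_coframe e z = vector [vector [1, 0, 0], vector [- (e * wave (z $ 1)) * z $ 2, 1, e * wave (z $ 1)],
     vector [- z $ 2, 0, 1]]"

definition iwasawa_frame :: "complex \<Rightarrow> complex^3 \<Rightarrow> complex^3^3" where
  "iwasawa_frame e z = vector [vector [1, 0, 0], vector [0, 1, - (e * wave (z $ 1))], vector [z $ 2, 0, 1]]"

lemma iwasawa_coframe_vec: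
  "iwasawa_coframe e z *v v = vector [v $ 1, v $ 2 + e * wave (z $ 1) * (v $ 3 - z $ 2 * v $ 1),
     v $ 3 - z $ 2 * v $ 1]"
  by (simp add: iwasawa_coframe_def vec_eq_iff forall_3 matrix_vector_mult_def sum_3 algebra_simps)

lemma group_heisenberg_group: "group heisenberg_group"
proof (rule groupI)
  fix z assume "z \<in> carrier heisenberg_group"
  have "vector [- z$1, - z$2, z$1 * z$2 - z$3] \<otimes>\<^bsub>heisenberg_group\<^esub> z = \<one>\<^bsub>heisenberg_group\<^esub>"
    by (simp add: heisenberg_group_def vec_eq_iff forall_3)
  then show "\<exists>y\<in>carrier heisenberg_group. y \<otimes>\<^bsub>heisenberg_group\<^esub> z = \<one>\<^bsub>heisenberg_group\<^esub>"
    by (rule bexI) (simp add: heisenberg_group_def)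
qed (simp_all add: heisenberg_group_def vec_eq_iff forall_3 algebra_simps)

lemma iwasawa_lattice_iff: "z \<in> iwasawa_lattice \<longleftrightarrow> (\<forall>i. z $ i \<in> gauss_ints)"
  by (simp add: iwasawa_lattice_def heis_matrix_def det_3 forall_3 gauss_ints_closed) blast

lemma subgroup_iwasawa_lattice: "subgroup iwasawa_lattice heisenberg_group"
proof (rule group.subgroupI[OF group_heisenberg_group])
  fix z assume "z \<in> iwasawa_lattice"
  moreover have "inv\<^bsub>heisenberg_group\<^esub> z = vector [- z$1, - z$2, z$1 * z$2 - z$3]"
    by (rule group.inv_equality[OF group_heisenberg_group])
      (simp_all add: heisenberg_group_def vec_eq_iff forall_3)
  ultimately show "inv\<^bsub>heisenberg_group\<^esub> z \<in> iwasawa_lattice"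
    by (simp add: iwasawa_lattice_iff forall_3 gauss_ints_closed diff_conv_add_uminus
        del: add_uminus_conv_diff)
next
  have "0 \<in> iwasawa_lattice"
    by (simp add: iwasawa_lattice_iff gauss_ints_closed)
  then show "iwasawa_lattice \<noteq> {}" by blast
qed (simp_all add: heisenberg_group_def iwasawa_lattice_iff forall_3 gauss_ints_closed)

text \<open>Right multiplication by \<open>\<gamma>\<close> is affine, with the linear part \<open>L\<close> below. Periodicity of \<open>wave\<close>
  makes \<open>h\<close> invariant, since \<open>z\<^sub>1\<close> changes by a Gaussian integer.\<close>

lemma invariant_coframe_iwasawa:
  "invariant_coframe (\<lambda>z. z <#\<^bsub>heisenberg_group\<^esub> iwasawa_lattice) (iwasawa_coframe e) (iwasawa_frame e)"
proof
  fix z w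
  have carrier: "carrier heisenberg_group = UNIV"
    by (simp add: heisenberg_group_def)
  assume "z <#\<^bsub>heisenberg_group\<^esub> iwasawa_lattice = w <#\<^bsub>heisenberg_group\<^esub> iwasawa_lattice"
  from lcoset_deck[OF group_heisenberg_group subgroup_iwasawa_lattice _ this] obtain \<gamma> where
    \<gamma>: "\<gamma> \<in> iwasawa_lattice" "z \<otimes>\<^bsub>heisenberg_group\<^esub> \<gamma> = w"
      "\<And>y. (y \<otimes>\<^bsub>heisenberg_group\<^esub> \<gamma>) <#\<^bsub>heisenberg_group\<^esub> iwasawa_lattice
        = y <#\<^bsub>heisenberg_group\<^esub> iwasawa_lattice"
    using carrier by blast
  define L :: "complex^3 \<Rightarrow> complex^3" where "L = (\<lambda>v. vector [v$1, v$2, v$3 + v$1 * \<gamma>$2])"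
  have "linear L"
    by (simp add: L_def linear_iff vec_eq_iff forall_3 algebra_simps)
  then have "((\<lambda>y. \<gamma> + L y) has_derivative L) (at y)" for y
    by (auto simp: linear_conv_bounded_linear intro!: derivative_eq_intros bounded_linear_imp_has_derivative)
  moreover have "y \<otimes>\<^bsub>heisenberg_group\<^esub> \<gamma> = \<gamma> + L y" for y
    by (simp add: heisenberg_group_def L_def vec_eq_iff forall_3)
  moreover have "iwasawa_coframe e (y \<otimes>\<^bsub>heisenberg_group\<^esub> \<gamma>) *v L v = iwasawa_coframe e y *v v" for y v
  proof -
    have "wave (y $ 1 + \<gamma> $ 1) = wave (y $ 1)" "wave (\<gamma> $ 1 + y $ 1) = wave (y $ 1)"
      using \<gamma>(1) wave_periodic[of "\<gamma> $ 1" "y $ 1"] by (simp_all add: iwasawa_lattice_iff add.commute)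
    then show ?thesis
      by (simp add: iwasawa_coframe_vec heisenberg_group_def L_def algebra_simps)
  qed
  ultimately show "\<exists>T T'. T z = w \<and> (\<forall>y. T y <#\<^bsub>heisenberg_group\<^esub> iwasawa_lattice
        = y <#\<^bsub>heisenberg_group\<^esub> iwasawa_lattice) \<and>
      (\<forall>y. (T has_derivative T' y) (at y)) \<and> (\<forall>y v. iwasawa_coframe e (T y) *v T' y v = iwasawa_coframe e y *v v)"
    using \<gamma>(2,3) by (intro exI[of _ "\<lambda>y. y \<otimes>\<^bsub>heisenberg_group\<^esub> \<gamma>"] exI[of _ "\<lambda>_. L"]) simp
next
  fix z show "iwasawa_coframe e z ** iwasawa_frame e z = mat 1" "iwasawa_frame e z ** iwasawa_coframe e z = mat 1"
    by (simp_all add: iwasawa_coframe_def iwasawa_frame_def matrix_matrix_mult_def mat_def vec_eq_iff forall_3 sum_3)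
next
  fix i j :: 3
  show "smooth_on UNIV (\<lambda>z. iwasawa_coframe e z $ i $ j)" "smooth_on UNIV (\<lambda>z. iwasawa_frame e z $ i $ j)"
    using exhaust_3[of i] exhaust_3[of j]
    by (auto simp: iwasawa_coframe_def iwasawa_frame_def smooth_on_intros smooth_on_wave)
qed

context
  fixes e :: complex
begin

interpretation invariant_coframe "\<lambda>z. z <#\<^bsub>heisenberg_group\<^esub> iwasawa_lattice"
  "iwasawa_coframe e" "iwasawa_frame e"
  by (rule invariant_coframe_iwasawa)

lemma iwasawa_ext_deriv:
  fixes x :: "complex^3"
  defines "h \<equiv> e * wave (x $ 1)"
  shows "ext_deriv (\<psi> 1) x = (\<lambda>u v. 0)"
  "ext_deriv (\<psi> 2) x = (\<lambda>u v. (pi * \<i> * h) * wedge (\<lambda>u. \<psi> 1 x u + cnj (\<psi> 1 x u)) (\<psi> 3 x) u v +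
     h * wedge (\<psi> 1 x) (\<lambda>u. \<psi> 2 x u - h * \<psi> 3 x u) u v)"
  "ext_deriv (\<psi> 3) x = wedge (\<psi> 1 x) (\<lambda>u. \<psi> 2 x u - h * \<psi> 3 x u)"
proof -
  have d1: "((\<lambda>y. \<psi> 1 y v) has_derivative (\<lambda>h. 0)) (at x)" for v
    by (simp add: iwasawa_coframe_vec)
  have d2: "((\<lambda>y. \<psi> 2 y v) has_derivative
      (\<lambda>k. e * (pi * \<i> * wave (x $ 1) * (k $ 1 + cnj (k $ 1))) * (v $ 3 - x $ 2 * v $ 1)
        - h * k $ 2 * v $ 1)) (at x)" for v
    by (auto simp: iwasawa_coframe_vec h_def algebra_simps intro!: derivative_eq_intros has_derivative_nth has_derivative_wave
        has_derivative_exp_compose)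
  have d3: "((\<lambda>y. \<psi> 3 y v) has_derivative (\<lambda>k. - k $ 2 * v $ 1)) (at x)" for v
    by (auto simp: iwasawa_coframe_vec intro!: derivative_eq_intros has_derivative_nth has_derivative_wave
        has_derivative_exp_compose)
  show "ext_deriv (\<psi> 1) x = (\<lambda>u v. 0)"
    by (intro ext, subst ext_deriv_eq[OF d1]) simp
  show "ext_deriv (\<psi> 2) x = (\<lambda>u v. (pi * \<i> * h) * wedge (\<lambda>u. \<psi> 1 x u + cnj (\<psi> 1 x u)) (\<psi> 3 x) u v +
     h * wedge (\<psi> 1 x) (\<lambda>u. \<psi> 2 x u - h * \<psi> 3 x u) u v)"
    by (intro ext, subst ext_deriv_eq[OF d2]) (simp add: iwasawa_coframe_vec wedge_def h_def algebra_simps)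
  show "ext_deriv (\<psi> 3) x = wedge (\<psi> 1 x) (\<lambda>u. \<psi> 2 x u - h * \<psi> 3 x u)"
    by (intro ext, subst ext_deriv_eq[OF d3]) (simp add: iwasawa_coframe_vec wedge_def h_def algebra_simps)
qed

lemma iwasawa_rows:
  fixes \<sigma> \<tau> :: complex
  assumes c: "c \<in> M" and x: "x \<in> chart_image c"
  shows "mubar (acs \<sigma> \<tau>) (\<omega> \<sigma> \<tau> j) c x = form_0_2 \<sigma> \<tau> x
    (if j = 1 then vector [\<sigma> * cnj (e * wave (x $ 1)), - \<sigma> * cnj (e * wave (x $ 1)) * (pi * \<i> + cnj (e * wave (x $ 1))), \<sigma> * \<sigma> * pi * \<i> * cnj (e * wave (x $ 1))]
     else if j = 2 then vector [\<tau>, - \<tau> * cnj (e * wave (x $ 1)), e * wave (x $ 1) * \<sigma> * \<tau>]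
     else vector [0, 0, \<sigma> * \<tau>])"
proof -
  define h where "h = e * wave (x $ 1)"
  note ext = iwasawa_ext_deriv[of x, folded h_def]
  have cnj2: "(\<lambda>u v. cnj (ext_deriv (\<psi> 2) x u v)) = (\<lambda>u v. - (pi * \<i> * cnj h) *
      wedge (\<lambda>u. \<psi> 1 x u + cnj (\<psi> 1 x u)) (\<lambda>u. cnj (\<psi> 3 x u)) u v + cnj h *
      wedge (\<lambda>u. cnj (\<psi> 1 x u)) (\<lambda>u. cnj (\<psi> 2 x u) - cnj h * cnj (\<psi> 3 x u)) u v)"
    by (simp add: ext wedge_def fun_eq_iff algebra_simps)
  have cnj3: "(\<lambda>u v. cnj (ext_deriv (\<psi> 3) x u v)) =
      wedge (\<lambda>u. cnj (\<psi> 1 x u)) (\<lambda>u. cnj (\<psi> 2 x u) - cnj h * cnj (\<psi> 3 x u))"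
    by (simp add: ext wedge_def fun_eq_iff algebra_simps)
  note proj = proj_0_2_linear proj_0_2_wedge part_0_1_linear part_0_1_\<psi>[OF c x]
    part_0_1_cnj_\<psi>[OF c x]
  note [simp] = form_0_2_def wedge_def fun_eq_iff
  show ?thesis
    unfolding h_def[symmetric]
    using exhaust_3[of j]
    by (elim disjE; simp only: mubar_\<omega> cnj2 cnj3; simp only: ext proj; simp add: algebra_simps)
qed

text \<open>Turning on \<open>\<tau>\<close>, then \<open>\<sigma>\<close>, then \<open>e\<close> adds one independent row at each step.\<close>

lemma iwasawa_constant_rank:
  fixes \<sigma> \<tau> s :: complex and I :: "3 set"
  assumes "(\<sigma>, \<tau>, e, I) \<in> {(0, 0, 0, {}), (0, s, 0, {2}), (s, s, 0, {2, 3}), (s, s, 1, UNIV)}" "s \<noteq> 0"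
  shows "constant_rank M (acs \<sigma> \<tau>) (card I)"
  unfolding constant_rank_def
proof (intro ballI)
  fix c x assume c: "c \<in> M" and x: "x \<in> chart_image c"
  let ?h = "e * wave (x $ 1)"
  let ?r = "\<lambda>j :: 3. (if j = 1 then vector [\<sigma> * cnj ?h, - \<sigma> * cnj ?h * (pi * \<i> + cnj ?h), \<sigma> * \<sigma> * pi * \<i> * cnj ?h]
     else if j = 2 then vector [\<tau>, - \<tau> * cnj ?h, ?h * \<sigma> * \<tau>]
     else vector [0, 0, \<sigma> * \<tau>]) :: complex^3"
  show "nijenhuis_rank M (acs \<sigma> \<tau>) c x = card I"
  proof (rule nijenhuis_rank_acs[OF c x iwasawa_rows[OF c x]])
    show "?r j = 0" if "j \<notin> I" for j :: 3
      using that exhaust_3[of j] assms(1) by (auto simp: vec_eq_iff forall_3)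
    fix f assume eq: "(\<Sum>j\<in>I. f j *s ?r j) = 0"
    show "\<forall>j\<in>I. f j = 0"
    proof (cases "I = UNIV")
      case True
      then have "1 \<in> I"
        by simp
      then have I: "\<sigma> = s" "\<tau> = s" "e = 1"
        using assms(1) by auto
      define g where "g = cnj (wave (x $ 1))"
      have g: "g \<noteq> 0" by (simp add: g_def)
      have eqs: "f 1 * (s * g) + f 2 * s = 0"
        "f 1 * (- s * g * (pi * \<i> + g)) + f 2 * (- s * g) = 0"
        "f 1 * (s * s * pi * \<i> * g) + f 2 * (cnj g * s * s) + f 3 * (s * s) = 0"
        using eq by (simp_all add: True sum_3 I vec_eq_iff forall_3 g_def)
      have f2: "f 2 = - f 1 * g"
        using eqs(1) \<open>s \<noteq> 0\<close> by (simp add: eq_neg_iff_add_eq_0 flip: mult.assoc) algebra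
      \<comment> \<open>substituting \<open>f 2\<close> cancels the quadratic terms in \<open>g\<close>; the derivative of \<open>wave\<close> remains\<close>
      have "f 1 * (s * g * pi * \<i>) = 0"
        using eqs(2) f2 by algebra
      then have "f 1 = 0"
        using g \<open>s \<noteq> 0\<close> by simp
      then show ?thesis
        using f2 eqs(3) \<open>s \<noteq> 0\<close> by (simp add: True forall_3)
    next
      case False
      then show ?thesis
        using eq assms by (auto simp: vec_eq_iff forall_3)
    qed
  qed
qed

end

section \<open>Nakamura manifolds\<close>

text \<open>From the invariant forms \<open>\<phi>\<^sub>1 = dz\<^sub>1\<close>, \<open>\<phi>\<^sub>2 = exp (- z\<^sub>1) dz\<^sub>2\<close>, \<open>\<phi>\<^sub>3 = exp z\<^sub>1 dz\<^sub>3\<close> the coframe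
  \<open>\<phi>\<^sub>1\<close>, \<open>\<phi>\<^sub>2\<close>, \<open>\<phi>\<^sub>3 + e \<phi>\<^sub>2\<close> is built with constant \<open>e\<close>, so that it is invariant under every lattice. As \<open>\<phi>\<^sub>2\<close>
  and \<open>\<phi>\<^sub>3\<close> scale in opposite ways under \<open>\<phi>\<^sub>1\<close>, mixing them puts a multiple of \<open>\<psi>\<^sub>1 \<and> \<psi>\<^sub>2\<close> into \<open>d\<psi>\<^sub>3\<close>. Its
  \<open>(0,2)\<close>-part, of second order in the deformation, provides the third direction.\<close>

definition nakamura_coframe :: "complex \<Rightarrow> complex^3 \<Rightarrow> complex^3^3" where
  "nakamura_coframe e z = vector [vector [1, 0, 0], vector [0, exp (- z $ 1), 0],
     vector [0, e * exp (- z $ 1), exp (z $ 1)]]"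

definition nakamura_frame :: "complex \<Rightarrow> complex^3 \<Rightarrow> complex^3^3" where
  "nakamura_frame e z = vector [vector [1, 0, 0], vector [0, exp (z $ 1), 0],
     vector [0, - e * exp (- z $ 1), exp (- z $ 1)]]"

lemma nakamura_coframe_vec:
  "nakamura_coframe e z *v v = vector [v $ 1, exp (- z $ 1) * v $ 2,
     e * (exp (- z $ 1) * v $ 2) + exp (z $ 1) * v $ 3]"
  by (simp add: nakamura_coframe_def vec_eq_iff forall_3 matrix_vector_mult_def sum_3 algebra_simps)

lemma invariant_coframe_nakamura:
  assumes "subgroup \<Gamma> nakamura_group"
  shows "invariant_coframe (\<lambda>z. \<Gamma> #>\<^bsub>nakamura_group\<^esub> z) (nakamura_coframe e) (nakamura_frame e)"
proof
  fix z w
  assume "\<Gamma> #>\<^bsub>nakamura_group\<^esub> z = \<Gamma> #>\<^bsub>nakamura_group\<^esub> w"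
  from rcoset_deck[OF group_nakamura_group assms _ this] obtain \<gamma> where
    \<gamma>: "\<gamma> \<otimes>\<^bsub>nakamura_group\<^esub> z = w"
      "\<And>y. \<Gamma> #>\<^bsub>nakamura_group\<^esub> (\<gamma> \<otimes>\<^bsub>nakamura_group\<^esub> y) = \<Gamma> #>\<^bsub>nakamura_group\<^esub> y"
    by (auto simp: nakamura_group_def)
  define L :: "complex^3 \<Rightarrow> complex^3"
    where "L = (\<lambda>v. vector [v$1, exp (\<gamma>$1) * v$2, exp (- \<gamma>$1) * v$3])"
  have "linear L"
    by (simp add: L_def linear_iff vec_eq_iff forall_3 algebra_simps)
  then have "((\<lambda>y. \<gamma> + L y) has_derivative L) (at y)" for y
    by (auto simp: linear_conv_bounded_linear intro!: derivative_eq_intros bounded_linear_imp_has_derivative)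
  moreover have "\<gamma> \<otimes>\<^bsub>nakamura_group\<^esub> y = \<gamma> + L y" for y
    by (simp add: nakamura_group_def L_def vec_eq_iff forall_3)
  moreover have "nakamura_coframe e (\<gamma> \<otimes>\<^bsub>nakamura_group\<^esub> y) *v L v = nakamura_coframe e y *v v" for y v
    by (simp add: nakamura_coframe_vec nakamura_group_def L_def exp_add exp_diff exp_minus field_simps)
  ultimately show "\<exists>T T'. T z = w \<and> (\<forall>y. \<Gamma> #>\<^bsub>nakamura_group\<^esub> T y = \<Gamma> #>\<^bsub>nakamura_group\<^esub> y) \<and>
      (\<forall>y. (T has_derivative T' y) (at y)) \<and> (\<forall>y v. nakamura_coframe e (T y) *v T' y v = nakamura_coframe e y *v v)"
    using \<gamma> by (intro exI[of _ "\<lambda>y. \<gamma> \<otimes>\<^bsub>nakamura_group\<^esub> y"] exI[of _ "\<lambda>_. L"]) simp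
next
  fix z show "nakamura_coframe e z ** nakamura_frame e z = mat 1" "nakamura_frame e z ** nakamura_coframe e z = mat 1"
    by (simp_all add: nakamura_coframe_def nakamura_frame_def matrix_matrix_mult_def mat_def vec_eq_iff forall_3
        sum_3 exp_minus)
next
  fix i j :: 3
  show "smooth_on UNIV (\<lambda>z. nakamura_coframe e z $ i $ j)" "smooth_on UNIV (\<lambda>z. nakamura_frame e z $ i $ j)"
    using exhaust_3[of i] exhaust_3[of j]
    by (auto simp: nakamura_coframe_def nakamura_frame_def smooth_on_intros)
qed

context
  fixes \<Gamma> :: "(complex^3) set" and e :: complex
  assumes \<Gamma>: "subgroup \<Gamma> nakamura_group"
begin

interpretation invariant_coframe "\<lambda>z. \<Gamma> #>\<^bsub>nakamura_group\<^esub> z" "nakamura_coframe e" "nakamura_frame e"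
  by (rule invariant_coframe_nakamura[OF \<Gamma>])

lemma nakamura_ext_deriv:
  "ext_deriv (\<psi> 1) x = (\<lambda>u v. 0)"
  "ext_deriv (\<psi> 2) x = wedge (\<psi> 2 x) (\<psi> 1 x)"
  "ext_deriv (\<psi> 3) x = wedge (\<psi> 1 x) (\<lambda>u. \<psi> 3 x u - 2 * e * \<psi> 2 x u)"
proof -
  have d1: "((\<lambda>y. \<psi> 1 y v) has_derivative (\<lambda>h. 0)) (at x)" for v
    by (simp add: nakamura_coframe_vec)
  have d2: "((\<lambda>y. \<psi> 2 y v) has_derivative (\<lambda>k. - k $ 1 * exp (- x $ 1) * v $ 2)) (at x)" for v
    by (auto simp: nakamura_coframe_vec intro!: derivative_eq_intros has_derivative_nth has_derivative_wave
        has_derivative_exp_compose)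
  have d3: "((\<lambda>y. \<psi> 3 y v) has_derivative
      (\<lambda>k. - e * k $ 1 * exp (- x $ 1) * v $ 2 + k $ 1 * exp (x $ 1) * v $ 3)) (at x)" for v
    by (auto simp: nakamura_coframe_vec algebra_simps intro!: derivative_eq_intros has_derivative_nth has_derivative_wave
        has_derivative_exp_compose)
  show "ext_deriv (\<psi> 1) x = (\<lambda>u v. 0)"
    by (intro ext, subst ext_deriv_eq[OF d1]) simp
  show "ext_deriv (\<psi> 2) x = wedge (\<psi> 2 x) (\<psi> 1 x)"
    by (intro ext, subst ext_deriv_eq[OF d2]) (simp add: nakamura_coframe_vec wedge_def algebra_simps)
  show "ext_deriv (\<psi> 3) x = wedge (\<psi> 1 x) (\<lambda>u. \<psi> 3 x u - 2 * e * \<psi> 2 x u)"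
    by (intro ext, subst ext_deriv_eq[OF d3]) (simp add: nakamura_coframe_vec wedge_def algebra_simps)
qed

lemma nakamura_rows:
  fixes \<sigma> \<tau> :: complex
  assumes c: "c \<in> M" and x: "x \<in> chart_image c"
  shows "mubar (acs \<sigma> \<tau>) (\<omega> \<sigma> \<tau> j) c x = form_0_2 \<sigma> \<tau> x
    (if j = 1 then vector [- \<sigma>, 0, 0]
     else if j = 2 then vector [- 2 * cnj e * \<tau>, \<tau>, - \<sigma> * \<tau>]
     else vector [0, 0, - 2 * e * \<sigma> * \<tau>])"
proof -
  note ext = nakamura_ext_deriv[of x]
  have cnj2: "(\<lambda>u v. cnj (ext_deriv (\<psi> 2) x u v)) =
      wedge (\<lambda>u. cnj (\<psi> 2 x u)) (\<lambda>u. cnj (\<psi> 1 x u))"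
    by (simp add: ext wedge_def fun_eq_iff algebra_simps)
  have cnj3: "(\<lambda>u v. cnj (ext_deriv (\<psi> 3) x u v)) =
      wedge (\<lambda>u. cnj (\<psi> 1 x u)) (\<lambda>u. cnj (\<psi> 3 x u) - 2 * cnj e * cnj (\<psi> 2 x u))"
    by (simp add: ext wedge_def fun_eq_iff algebra_simps)
  note proj = proj_0_2_linear proj_0_2_wedge part_0_1_linear part_0_1_\<psi>[OF c x]
    part_0_1_cnj_\<psi>[OF c x]
  note [simp] = form_0_2_def wedge_def fun_eq_iff
  show ?thesis
    using exhaust_3[of j]
    by (elim disjE; simp only: mubar_\<omega> cnj2 cnj3; simp only: ext proj; simp add: algebra_simps)
qed

text \<open>The row of \<open>\<omega>\<^sub>2\<close> needs \<open>\<tau>\<close>, that of \<open>\<omega>\<^sub>1\<close> needs \<open>\<sigma>\<close>, and that of \<open>\<omega>\<^sub>3\<close> needs \<open>\<sigma>\<close>, \<open>\<tau>\<close> and \<open>e\<close>.\<close>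

lemma nakamura_constant_rank:
  fixes \<sigma> \<tau> s :: complex and I :: "3 set"
  assumes "(\<sigma>, \<tau>, e, I) \<in> {(0, 0, 0, {}), (0, s, 0, {2}), (s, s, 0, {1, 2}), (s, s, 1, UNIV)}" "s \<noteq> 0"
  shows "constant_rank M (acs \<sigma> \<tau>) (card I)"
  unfolding constant_rank_def
proof (intro ballI)
  fix c x assume c: "c \<in> M" and x: "x \<in> chart_image c"
  let ?r = "\<lambda>j :: 3. (if j = 1 then vector [- \<sigma>, 0, 0]
     else if j = 2 then vector [- 2 * cnj e * \<tau>, \<tau>, - \<sigma> * \<tau>]
     else vector [0, 0, - 2 * e * \<sigma> * \<tau>]) :: complex^3"
  show "nijenhuis_rank M (acs \<sigma> \<tau>) c x = card I"
  proof (rule nijenhuis_rank_acs[OF c x nakamura_rows[OF c x]])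
    show "?r j = 0" if "j \<notin> I" for j :: 3
      using that exhaust_3[of j] assms(1) by (auto simp: vec_eq_iff forall_3)
    fix f assume "(\<Sum>j\<in>I. f j *s ?r j) = 0"
    then have "\<forall>j. j \<in> I \<longrightarrow> f j = 0"
      unfolding forall_3 using assms by (auto simp: vec_eq_iff forall_3 sum_3)
    then show "\<forall>j\<in>I. f j = 0"
      by blast
  qed
qed

end

section \<open>Deformations of every rank\<close>

lemma torus_every_rank:
  assumes "k \<in> {0, 1, 2, 3::nat}"
  defines "q \<equiv> \<lambda>z. z <#\<^bsub>translation_group\<^esub> {z. \<forall>i. z $ i \<in> gauss_ints}"
  shows "\<exists>A B a b. invariant_coframe q A B \<and>
    (\<forall>s. s \<noteq> 0 \<longrightarrow> constant_rank (quotient_atlas q) (invariant_coframe.acs q A B (s * a) (s * b)) k)"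
proof -
  have *: ?thesis if card: "card ((if b = 0 then {} else {3}) \<union> (if a = 0 then {} else {1, 2::3})) = k" for a b :: complex
  proof (intro exI conjI allI impI)
    show "invariant_coframe q (torus_coframe a b) (torus_frame a b)"
      unfolding q_def by (rule invariant_coframe_torus)
    show "constant_rank (quotient_atlas q)
        (invariant_coframe.acs q (torus_coframe a b) (torus_frame a b) (s * 1) (s * 0)) k"
      if "s \<noteq> 0" for s
      using torus_constant_rank[where a = a and b = b, OF that refl] by (simp only: card q_def mult_1_right mult_zero_right)
  qed
  show ?thesis
    using assms(1) *[of 0 0] *[of 1 0] *[of 0 1] *[of 1 1] by auto
qed

lemma iwasawa_every_rank:
  assumes "k \<in> {0, 1, 2, 3::nat}"
  defines "q \<equiv> \<lambda>z. z <#\<^bsub>heisenberg_group\<^esub> iwasawa_lattice"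
  shows "\<exists>A B a b. invariant_coframe q A B \<and>
    (\<forall>s. s \<noteq> 0 \<longrightarrow> constant_rank (quotient_atlas q) (invariant_coframe.acs q A B (s * a) (s * b)) k)"
proof -
  have *: ?thesis
    if "(a, b, e, I) \<in> {(0, 0, 0, {}), (0, 1, 0, {2}), (1, 1, 0, {2, 3}), (1, 1, 1, UNIV :: 3 set)}"
      "card I = k" for a b e :: complex and I
  proof (intro exI conjI allI impI)
    show "invariant_coframe q (iwasawa_coframe e) (iwasawa_frame e)"
      unfolding q_def by (rule invariant_coframe_iwasawa)
    show "constant_rank (quotient_atlas q)
        (invariant_coframe.acs q (iwasawa_coframe e) (iwasawa_frame e) (s * a) (s * b)) k"
      if "s \<noteq> 0" for s
      unfolding q_def \<open>card I = k\<close>[symmetric]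
      using \<open>(a, b, e, I) \<in> _\<close> that by (intro iwasawa_constant_rank[of _ _ e I s]) auto
  qed
  show ?thesis
    using assms(1) *[of 0 0 0 "{}"] *[of 0 1 0 "{2}"] *[of 1 1 0 "{2, 3}"] *[of 1 1 1 UNIV] by auto
qed

lemma nakamura_every_rank:
  assumes "subgroup \<Gamma> nakamura_group" "k \<in> {0, 1, 2, 3::nat}"
  defines "q \<equiv> \<lambda>z. \<Gamma> #>\<^bsub>nakamura_group\<^esub> z"
  shows "\<exists>A B a b. invariant_coframe q A B \<and>
    (\<forall>s. s \<noteq> 0 \<longrightarrow> constant_rank (quotient_atlas q) (invariant_coframe.acs q A B (s * a) (s * b)) k)"
proof -
  have *: ?thesis
    if "(a, b, e, I) \<in> {(0, 0, 0, {}), (0, 1, 0, {2}), (1, 1, 0, {1, 2}), (1, 1, 1, UNIV :: 3 set)}"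
      "card I = k" for a b e :: complex and I
  proof (intro exI conjI allI impI)
    show "invariant_coframe q (nakamura_coframe e) (nakamura_frame e)"
      unfolding q_def by (rule invariant_coframe_nakamura[OF assms(1)])
    show "constant_rank (quotient_atlas q)
        (invariant_coframe.acs q (nakamura_coframe e) (nakamura_frame e) (s * a) (s * b)) k"
      if "s \<noteq> 0" for s
      unfolding q_def \<open>card I = k\<close>[symmetric]
      using \<open>(a, b, e, I) \<in> _\<close> that by (intro nakamura_constant_rank[OF assms(1), of _ _ e I s]) auto
  qed
  show ?thesis
    using assms(2) *[of 0 0 0 "{}"] *[of 0 1 0 "{2}"] *[of 1 1 0 "{1, 2}"] *[of 1 1 1 UNIV] by auto
qed

theorem proposition4p4:
  fixes M :: "((complex^3) set, complex^3) chart set"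
  assumes "M = torus6 \<or> M = iwasawa_manifold \<or>
           (\<exists>\<Gamma>. nakamura_lattice \<Gamma> \<and> M = nakamura_manifold \<Gamma>)"
  shows "\<exists>J\<^sub>0. almost_complex_structure M J\<^sub>0 \<and> integrable_acs M J\<^sub>0 \<and>
     (\<forall>k\<in>{0, 1, 2, 3::nat}. \<exists>\<epsilon>>0. \<exists>J. acs_curve M J\<^sub>0 \<epsilon> J \<and>
        (\<forall>s. s \<noteq> 0 \<and> norm s < \<epsilon> \<longrightarrow> constant_rank M (J s) k)) \<and>
     (\<forall>U. openin (C0_topology M) U \<and> J\<^sub>0 \<in> U \<longrightarrow>
        (\<forall>k\<in>{0, 1, 2, 3::nat}. \<exists>J\<in>U. almost_complex_structure M J \<and> constant_rank M J k))"
  using assms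
proof (elim disjE exE conjE)
  assume "M = torus6"
  then show ?thesis
    unfolding torus6_def using constant_rank_deformations[OF torus_every_rank] by simp
next
  assume "M = iwasawa_manifold"
  then show ?thesis
    unfolding iwasawa_manifold_def using constant_rank_deformations[OF iwasawa_every_rank] by simp
next
  fix \<Gamma> assume "nakamura_lattice \<Gamma>" "M = nakamura_manifold \<Gamma>"
  then show ?thesis
    unfolding nakamura_manifold_def nakamura_lattice_def
    using constant_rank_deformations[OF nakamura_every_rank] by simp
qed

end
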